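(* Let $W$ be any binary memoryless symmetric (BMS) channel with capacity $C \in (0,1)$. For every sequence of Reed--Muller codes $\mathrm{RM}(r_n,m_n)$ with strictly increasing blocklength $2^{m_n}$ and rate $R(r_n,m_n)$ converging to some $R \in [0,C)$, the bit-error probability under bit-MAP decoding converges to zero, i.e. $\max_{i \in [2^{m_n}]} \Pr\big(X_i \neq \phi_i(\mathbf{Y})\big) \to 0$ as $n\to\infty$.
   Context: A BMS channel has input alphabet $\{\pm 1\}$, output alphabet the extended reals $\overline{\mathbb{R}}$, and transition density satisfying $w(y\mid +1)=w(-y\mid -1)$; it is used memorylessly (independent identically distributed uses given the inputs). Its capacity is $I(X;Y)$ for uniform input $X$. For integers $0\le r\le m$, $\mathrm{RM}(r,m)\subseteq\mathbb{F}_2^{2^m}$ is the set of vectors $(p(\tau^{-1}(0)),\dots,p(\tau^{-1}(2^m-1)))$ where $p$ ranges over $\mathbb{F}_2$-multilinear polynomials in $m$ indeterminates of total degree at most $r$ and $\tau(\mathbf{v})=\sum_{j=0}^{m-1} v_j 2^j$ for $\mathbf{v}\in\mathbb{F}_2^m$. Its rate is $R(r,m)=2^{-m}\sum_{i=0}^r\binom{m}{i}$. $[N]=\{0,\dots,N-1\}$. The transmitted vector $\mathbf{X}=(-1)^{\mathbf{u}}$ (BPSK) where $\mathbf{u}$ is a uniformly random codeword, $\mathbf{Y}$ is the channel output, and $\phi_i(\mathbf{y})=\arg\max_{x\in\{\pm1\}}\Pr(X_i=x\mid \mathbf{Y}=\mathbf{y})$ is the bit-MAP decision for code bit $i$. 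*)

theory Defs
  imports "HOL-Probability.Probability"
begin

text \<open>Codewords are vectors over F2 = bool, indexed by nat, zero (False) outside [2^m].
  An F2-multilinear polynomial of degree at most r in m indeterminates is given by its
  coefficient function c on monomials, i.e. on subsets S of {..<m} with card S \<le> r.
  Its value at v is the F2-sum (parity) of the monomials with coefficient 1 that
  evaluate to 1.\<close>

definition monomials :: "nat \<Rightarrow> nat \<Rightarrow> nat set set" where
  "monomials r m = {S. S \<subseteq> {..<m} \<and> card S \<le> r}"

definition mpoly_eval :: "nat \<Rightarrow> nat \<Rightarrow> (nat set \<Rightarrow> bool) \<Rightarrow> (nat \<Rightarrow> bool) \<Rightarrow> bool" where
  "mpoly_eval r m c v = odd (card {S \<in> monomials r m. c S \<and> (\<forall>j\<in>S. v j)})"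

definition tau_inv :: "nat \<Rightarrow> (nat \<Rightarrow> bool)" where
  "tau_inv k = (\<lambda>j. odd (k div 2 ^ j))"

definition RM :: "nat \<Rightarrow> nat \<Rightarrow> (nat \<Rightarrow> bool) set" where
  "RM r m = {u. \<exists>c. u = (\<lambda>k. if k < 2 ^ m then mpoly_eval r m c (tau_inv k) else False)}"

definition RM_rate :: "nat \<Rightarrow> nat \<Rightarrow> real" where
  "RM_rate r m = (\<Sum>i\<le>r. real (m choose i)) / 2 ^ m"

text \<open>A BMS channel is given by a reference measure mu on the extended reals (Borel sets,
  sigma-finite, invariant under negation) and transition densities w x y (x = +1 or -1)
  with respect to mu, satisfying w(y | +1) = w(-y | -1).\<close>

definition BMS_channel :: "ereal measure \<Rightarrow> (real \<Rightarrow> ereal \<Rightarrow> real) \<Rightarrow> bool" where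
  "BMS_channel \<mu> w \<longleftrightarrow>
     sets \<mu> = sets borel \<and> sigma_finite_measure \<mu> \<and> distr \<mu> \<mu> uminus = \<mu> \<and>
     (\<forall>x\<in>{1, -1}. w x \<in> borel_measurable \<mu> \<and> (\<forall>y. 0 \<le> w x y) \<and>
                   (\<integral>\<^sup>+ y. ennreal (w x y) \<partial>\<mu>) = 1) \<and>
     (\<forall>y. w 1 y = w (-1) (-y))"

definition joint_law :: "ereal measure \<Rightarrow> (real \<Rightarrow> ereal \<Rightarrow> real) \<Rightarrow> (real \<times> ereal) measure" where
  "joint_law \<mu> w = density (count_space {1, -1} \<Otimes>\<^sub>M \<mu>) (\<lambda>(x, y). ennreal (w x y / 2))"

definition capacity :: "ereal measure \<Rightarrow> (real \<Rightarrow> ereal \<Rightarrow> real) \<Rightarrow> real" where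
  "capacity \<mu> w = prob_space.mutual_information (joint_law \<mu> w) 2 (count_space {1, -1}) \<mu> fst snd"

definition bpsk :: "bool \<Rightarrow> real" where
  "bpsk b = (if b then -1 else 1)"

definition likelihood :: "(real \<Rightarrow> ereal \<Rightarrow> real) \<Rightarrow> nat \<Rightarrow> (nat \<Rightarrow> bool) \<Rightarrow> (nat \<Rightarrow> ereal) \<Rightarrow> real" where
  "likelihood w N v y = (\<Prod>j<N. w (bpsk (v j)) (y j))"

definition posterior ::
  "(real \<Rightarrow> ereal \<Rightarrow> real) \<Rightarrow> (nat \<Rightarrow> bool) set \<Rightarrow> nat \<Rightarrow> nat \<Rightarrow> real \<Rightarrow> (nat \<Rightarrow> ereal) \<Rightarrow> real" where
  "posterior w Cd N i x y =
     (\<Sum>v\<in>{v\<in>Cd. bpsk (v i) = x}. likelihood w N v y) / (\<Sum>v\<in>Cd. likelihood w N v y)"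

text \<open>Bit-MAP error event for bit i when codeword u was sent: the bit-MAP decision
  phi_i(y) (argmax over x of the posterior) differs from X_i = bpsk (u i).  Ties are counted
  as errors, so this bounds the error probability of bit-MAP decoding for any tie-breaking
  rule.\<close>
definition bitMAP_error :: "(real \<Rightarrow> ereal \<Rightarrow> real) \<Rightarrow> (nat \<Rightarrow> bool) set \<Rightarrow> nat \<Rightarrow> nat \<Rightarrow> (nat \<Rightarrow> bool) \<Rightarrow> (nat \<Rightarrow> ereal) \<Rightarrow> bool" where
  "bitMAP_error w Cd N i u y \<longleftrightarrow>
     posterior w Cd N i (bpsk (u i)) y \<le> posterior w Cd N i (- bpsk (u i)) y"

definition bitMAP_error_prob ::
  "ereal measure \<Rightarrow> (real \<Rightarrow> ereal \<Rightarrow> real) \<Rightarrow> (nat \<Rightarrow> bool) set \<Rightarrow> nat \<Rightarrow> nat \<Rightarrow> ennreal" where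
  "bitMAP_error_prob \<mu> w Cd N i =
     (\<Sum>u\<in>Cd. \<integral>\<^sup>+ y. indicator {y. bitMAP_error w Cd N i u y} y * ennreal (likelihood w N u y)
                  \<partial>(PiM {..<N} (\<lambda>_. \<mu>))) / of_nat (card Cd)"

end

theory Submission
  imports Defs
begin

text \<open>Let \<open>q(m)\<close> be one minus the mean squared error of estimating one bit of \<open>RM(r,m)\<close> from the
  outputs of all other bits.

  Entropy: if \<open>q(m)\<close> is small, every output is almost independent of the others, so the output
  entropy is almost maximal and the rate is almost the capacity. Quantitatively
  \<open>q(m) \<ge> ln 2 * (capacity - rate)\<close>.

  Two looks: \<open>RM(r,m+1)\<close> restricted to any of the \<open>2^m\<close> hyperplanes that are graphs of linear
  functionals is \<open>RM(r,m)\<close>, so two such hyperplanes give two estimates of the bit at the origin.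
  Under the all-zero codeword the covariance of the two estimates is the variance of one of them
  conditioned on the outputs in the intersection. A fixed nonzero point lies in the kernel of half of
  the functionals, so by the chain rule for the variance this is on average at most half of the
  full variance \<open>q - q^2\<close>. The best multiple of the sum of the two estimates then gives
  \<open>q(m+1) \<ge> 4 q(m) / (3 + q(m))\<close>, which drives \<open>q\<close> to \<open>1\<close> geometrically.

  A bounded number of steps changes the rate by \<open>O(1 / sqrt m)\<close> only, and the bit error probability
  is at most \<open>1 - q(m)\<close>.\<close>

section \<open>Sequences of independent identically distributed symbols\<close>

text \<open>Why the all-zero codeword may stand for a random one: flipping the outputs along a
  codeword changes the sign of the estimate f of bit b exactly when that codeword has a one at b. So
  E f under the zero word equals E (X_b f) under a random word, and since f is a conditional mean,
  both E f and E f^2 equal q. Two looks with covariance term c = E (f h) make \<alpha> * (f + h) a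
  competitor of quality 4 \<alpha> q - \<alpha>^2 (2 q + 2 c); c is at most (q + q^2) / 2 on
  average. The resulting step multiplies 1 - q by 3 / (3 + q), so any positive starting value
  suffices. The recursion keeps r and raises m, which lowers the rate. The entropy bound must
  therefore be applied to the code with the same r and j fewer variables, whose rate is slightly
  higher but still below capacity. All lengths share one infinite sequence of outputs, so that
  hyperplanes are moved by permutations of indices. Densities are taken relative to the law under
  uniform input: each is at most 2, so every function that occurs is bounded, even where a log
  likelihood ratio is infinite.\<close>

abbreviation iid :: "'a measure \<Rightarrow> (nat \<Rightarrow> 'a) measure" where
  "iid M \<equiv> PiM UNIV (\<lambda>_. M)"

text \<open>A pointwise condition in place of measurability for a sub-sigma-algebra. It lets
  integrals over the infinite sequence move to a finite product.\<close>

definition depends_on :: "nat set \<Rightarrow> ((nat \<Rightarrow> 'a) \<Rightarrow> 'b) \<Rightarrow> bool" where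
  "depends_on J h \<longleftrightarrow> (\<forall>y z. (\<forall>k\<in>J. y k = z k) \<longrightarrow> h y = h z)"

lemma depends_onD: "depends_on J h \<Longrightarrow> (\<And>k. k \<in> J \<Longrightarrow> y k = z k) \<Longrightarrow> h y = h z"
  by (auto simp: depends_on_def)

lemma depends_on_combine:
  "depends_on J g \<Longrightarrow> depends_on J h \<Longrightarrow> depends_on J (\<lambda>y. F (g y) (h y))"
  unfolding depends_on_def by (auto intro!: arg_cong2[of _ _ _ _ F])

text \<open>With \<open>z\<close> an independent copy of \<open>y\<close>, integrating over
  \<open>z\<close> alone conditions on the coordinates in \<open>S\<close>.\<close>

definition splice_at :: "nat set \<Rightarrow> (nat \<Rightarrow> 'a) \<Rightarrow> (nat \<Rightarrow> 'a) \<Rightarrow> nat \<Rightarrow> 'a" where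
  "splice_at S y z = (\<lambda>k. if k \<in> S then y k else z k)"

lemma measurable_iidI:
  assumes "space M = UNIV" "\<And>k. (\<lambda>x. f x k) \<in> measurable N M"
  shows "f \<in> measurable N (iid M)"
  using assms by (intro measurable_PiM_single') auto

lemma measurable_splice_at:
  assumes "space M = UNIV"
  shows "(\<lambda>p. splice_at S (fst p) (snd p)) \<in> measurable (iid M \<Otimes>\<^sub>M iid M) (iid M)"
proof (rule measurable_iidI[OF assms])
  fix k
  show "(\<lambda>p. splice_at S (fst p) (snd p) k) \<in> measurable (iid M \<Otimes>\<^sub>M iid M) M"
    by (cases "k \<in> S") (auto simp: splice_at_def)
qed

text \<open>The preimage of a cylinder is a rectangle: coordinates in \<open>S\<close> constrain
  only the first sequence, all others only the second.\<close>

lemma distr_iid_splice_at: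
  assumes "prob_space M" "space M = UNIV"
  shows "distr (iid M \<Otimes>\<^sub>M iid M) (iid M) (\<lambda>p. splice_at S (fst p) (snd p)) = iid M"
proof -
  interpret M: prob_space M by fact
  interpret product_prob_space "\<lambda>_::nat. M" UNIV by unfold_locales
  interpret PP: pair_prob_space "iid M" "iid M" ..
  show ?thesis
  proof (rule PiM_eq)
    fix J :: "nat set" and F
    assume J: "finite J" and F: "\<And>j. j \<in> J \<Longrightarrow> F j \<in> sets M"
    let ?\<phi> = "\<lambda>p. splice_at S (fst p) (snd p)"
    have emb: "prod_emb UNIV (\<lambda>_. M) K (Pi\<^sub>E K F) = {y. \<forall>k\<in>K. y k \<in> F k}" for K
      using assms by (auto simp: prod_emb_def PiE_def Pi_def)
    have s: "prod_emb UNIV (\<lambda>_. M) K (Pi\<^sub>E K F) \<in> sets (iid M)" if "K \<subseteq> J" for K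
      using that J F by (intro sets_PiM_I) (auto intro: finite_subset)
    have "?\<phi> -` prod_emb UNIV (\<lambda>_. M) J (Pi\<^sub>E J F) \<inter> space (iid M \<Otimes>\<^sub>M iid M)
        = prod_emb UNIV (\<lambda>_. M) (J \<inter> S) (Pi\<^sub>E (J \<inter> S) F) \<times> prod_emb UNIV (\<lambda>_. M) (J - S) (Pi\<^sub>E (J - S) F)"
      using assms by (auto simp: emb space_pair_measure space_PiM splice_at_def split: if_splits)
    then have "emeasure (distr (iid M \<Otimes>\<^sub>M iid M) (iid M) ?\<phi>) (prod_emb UNIV (\<lambda>_. M) J (Pi\<^sub>E J F))
        = emeasure (iid M \<Otimes>\<^sub>M iid M)
           (prod_emb UNIV (\<lambda>_. M) (J \<inter> S) (Pi\<^sub>E (J \<inter> S) F) \<times> prod_emb UNIV (\<lambda>_. M) (J - S) (Pi\<^sub>E (J - S) F))"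
      using measurable_splice_at[OF assms(2)] s[of J] by (subst emeasure_distr) auto
    also have "\<dots> = (\<Prod>j\<in>J \<inter> S. emeasure M (F j)) * (\<Prod>j\<in>J - S. emeasure M (F j))"
      using J F by (subst P.emeasure_pair_measure_Times)
        (auto intro!: s arg_cong2[of _ _ _ _ "(*)"] emeasure_PiM_emb)
    also have "\<dots> = (\<Prod>j\<in>J. emeasure M (F j))"
      using J by (subst prod.union_disjoint[symmetric]) (auto intro!: prod.cong)
    finally show "emeasure (distr (iid M \<Otimes>\<^sub>M iid M) (iid M) ?\<phi>) (prod_emb UNIV (\<lambda>_. M) J (Pi\<^sub>E J F))
        = (\<Prod>j\<in>J. emeasure M (F j))" .
  qed simp
qed

lemma distr_iid_reindex:
  assumes "prob_space M" "inj \<rho>"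
  shows "distr (iid M) (iid M) (\<lambda>y k. y (\<rho> k)) = iid M"
  using distr_PiM_reindex[of UNIV "\<lambda>_. M" \<rho> UNIV] assms by (simp add: restrict_def)

lemma distr_iid_map:
  assumes "prob_space M" "space M = UNIV"
    and \<phi>: "\<And>k. \<phi> k \<in> measurable M M" "\<And>k. distr M M (\<phi> k) = M"
  shows "distr (iid M) (iid M) (\<lambda>y k. \<phi> k (y k)) = iid M"
proof -
  interpret M: prob_space M by fact
  interpret product_prob_space "\<lambda>_::nat. M" UNIV by unfold_locales
  note \<phi>(1)[measurable]
  have m: "(\<lambda>y k. \<phi> k (y k)) \<in> measurable (iid M) (iid M)"
    by (intro measurable_iidI assms) simp
  show ?thesis
  proof (rule PiM_eq)
    fix J :: "nat set" and F
    assume J: "finite J" and F: "\<And>j. j \<in> J \<Longrightarrow> F j \<in> sets M"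
    have emb: "prod_emb UNIV (\<lambda>_. M) J (Pi\<^sub>E J F) = {y. \<forall>k\<in>J. y k \<in> F k}" for F :: "nat \<Rightarrow> 'a set"
      using assms by (auto simp: prod_emb_def PiE_def Pi_def)
    have s: "prod_emb UNIV (\<lambda>_. M) J (Pi\<^sub>E J F) \<in> sets (iid M)"
      using J F by (intro sets_PiM_I) (auto intro: finite_subset)
    have "(\<lambda>y k. \<phi> k (y k)) -` prod_emb UNIV (\<lambda>_. M) J (Pi\<^sub>E J F) \<inter> space (iid M)
        = prod_emb UNIV (\<lambda>_. M) J (Pi\<^sub>E J (\<lambda>k. \<phi> k -` F k \<inter> space M))"
      using assms by (auto simp: emb space_PiM)
    then have "emeasure (distr (iid M) (iid M) (\<lambda>y k. \<phi> k (y k))) (prod_emb UNIV (\<lambda>_. M) J (Pi\<^sub>E J F))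
        = emeasure (iid M) (prod_emb UNIV (\<lambda>_. M) J (Pi\<^sub>E J (\<lambda>k. \<phi> k -` F k \<inter> space M)))"
      by (subst emeasure_distr) (auto intro: m s)
    also have "\<dots> = (\<Prod>j\<in>J. emeasure M (\<phi> j -` F j \<inter> space M))"
      using J F by (intro emeasure_PiM_emb) auto
    also have "\<dots> = (\<Prod>j\<in>J. emeasure (distr M M (\<phi> j)) (F j))"
      using F by (intro prod.cong) (auto simp: emeasure_distr)
    finally show "emeasure (distr (iid M) (iid M) (\<lambda>y k. \<phi> k (y k))) (prod_emb UNIV (\<lambda>_. M) J (Pi\<^sub>E J F))
        = (\<Prod>j\<in>J. emeasure M (F j))" by (simp add: \<phi>(2))
  qed simp
qed

lemma measurable_depends_on:
  assumes h: "h \<in> measurable (iid M) N" and dep: "depends_on J h" and M: "space M = UNIV"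
  shows "h \<in> measurable (PiM J (\<lambda>_. M)) N"
proof -
  \<comment> \<open>On the space of \<open>PiM J\<close> this map is the identity, because its
    points are \<open>undefined\<close> off \<open>J\<close>.\<close>
  have "(\<lambda>y k. if k \<in> J then y k else undefined) \<in> measurable (PiM J (\<lambda>_. M)) (iid M)"
  proof (rule measurable_iidI[OF M])
    fix k show "(\<lambda>y. if k \<in> J then y k else undefined) \<in> measurable (PiM J (\<lambda>_. M)) M"
      by (cases "k \<in> J") (auto simp: M)
  qed
  from measurable_compose[OF this h] show ?thesis
    by (rule measurable_cong[THEN iffD1, rotated]) (auto intro!: depends_onD[OF dep])
qed

lemma distr_iid_restrict:
  assumes "prob_space M" "finite J"
  shows "distr (iid M) (PiM J (\<lambda>_. M)) (\<lambda>y. restrict y J) = PiM J (\<lambda>_. M)"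
proof -
  interpret M: prob_space M by fact
  interpret product_prob_space "\<lambda>_::nat. M" UNIV by unfold_locales
  show ?thesis using distr_PiM_restrict_finite[of J] assms by simp
qed

lemma integral_iid_depends_on:
  fixes h :: "(nat \<Rightarrow> 'a) \<Rightarrow> real"
  assumes M: "prob_space M" "space M = UNIV" and "finite J"
    and h: "h \<in> borel_measurable (iid M)" "depends_on J h"
  shows "integral\<^sup>L (iid M) h = integral\<^sup>L (PiM J (\<lambda>_. M)) h"
proof -
  have "integral\<^sup>L (PiM J (\<lambda>_. M)) h = (\<integral>y. h (restrict y J) \<partial>iid M)"
    by (subst distr_iid_restrict[OF M(1) \<open>finite J\<close>, symmetric], subst integral_distr)
       (auto intro!: measurable_restrict_subset measurable_depends_on[OF h M(2)])
  also have "\<dots> = integral\<^sup>L (iid M) h"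
    by (intro Bochner_Integration.integral_cong refl depends_onD[OF h(2)]) auto
  finally show ?thesis ..
qed

lemma nn_integral_iid_depends_on:
  fixes h :: "(nat \<Rightarrow> 'a) \<Rightarrow> ennreal"
  assumes M: "prob_space M" "space M = UNIV" and "finite J"
    and h: "h \<in> borel_measurable (iid M)" "depends_on J h"
  shows "integral\<^sup>N (iid M) h = integral\<^sup>N (PiM J (\<lambda>_. M)) h"
proof -
  have "integral\<^sup>N (PiM J (\<lambda>_. M)) h = (\<integral>\<^sup>+y. h (restrict y J) \<partial>iid M)"
    by (subst distr_iid_restrict[OF M(1) \<open>finite J\<close>, symmetric], subst nn_integral_distr)
       (auto intro!: measurable_restrict_subset measurable_depends_on[OF h M(2)])
  also have "\<dots> = integral\<^sup>N (iid M) h"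
    by (intro nn_integral_cong depends_onD[OF h(2)]) auto
  finally show ?thesis ..
qed

lemma PiM_density:
  assumes "sigma_finite_measure M" "prob_space (density M f)" "finite J"
    and f[measurable]: "f \<in> borel_measurable M"
  shows "PiM J (\<lambda>_. density M f) = density (PiM J (\<lambda>_. M)) (\<lambda>y. \<Prod>j\<in>J. f (y j))"
proof -
  interpret M: sigma_finite_measure M by fact
  interpret D: prob_space "density M f" by fact
  interpret P: product_sigma_finite "\<lambda>_. M" by standard
  interpret R: product_sigma_finite "\<lambda>_. density M f" by standard
  show ?thesis
  proof (rule R.PiM_eqI[OF \<open>finite J\<close>, symmetric])
    show "sets (density (PiM J (\<lambda>_. M)) (\<lambda>y. \<Prod>j\<in>J. f (y j))) = sets (PiM J (\<lambda>_. density M f))"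
      by (auto intro!: sets_PiM_cong)
    fix A assume "\<And>i. i \<in> J \<Longrightarrow> A i \<in> sets (density M f)"
    then have A[measurable]: "i \<in> J \<Longrightarrow> A i \<in> sets M" for i by simp
    have [measurable]: "Pi\<^sub>E J A \<in> sets (PiM J (\<lambda>_. M))"
      using A \<open>finite J\<close> by (intro sets_PiM_I_finite) auto
    have "emeasure (density (PiM J (\<lambda>_. M)) (\<lambda>y. \<Prod>j\<in>J. f (y j))) (Pi\<^sub>E J A)
        = (\<integral>\<^sup>+y. (\<Prod>j\<in>J. f (y j)) * indicator (Pi\<^sub>E J A) y \<partial>PiM J (\<lambda>_. M))"
      by (subst emeasure_density) auto
    also have "\<dots> = (\<integral>\<^sup>+y. (\<Prod>j\<in>J. f (y j) * indicator (A j) (y j)) \<partial>PiM J (\<lambda>_. M))"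
    proof (rule nn_integral_cong)
      fix y assume "y \<in> space (PiM J (\<lambda>_. M))"
      then have "y \<in> Pi\<^sub>E J A \<longleftrightarrow> (\<forall>j\<in>J. y j \<in> A j)"
        by (auto simp: space_PiM PiE_def)
      then have "indicator (Pi\<^sub>E J A) y = (\<Prod>j\<in>J. indicator (A j) (y j) :: ennreal)"
        using \<open>finite J\<close> by (auto simp: indicator_def prod_zero_iff)
      then show "(\<Prod>j\<in>J. f (y j)) * indicator (Pi\<^sub>E J A) y = (\<Prod>j\<in>J. f (y j) * indicator (A j) (y j))"
        by (simp add: prod.distrib)
    qed
    also have "\<dots> = (\<Prod>j\<in>J. \<integral>\<^sup>+y. f y * indicator (A j) y \<partial>M)"
      by (rule P.product_nn_integral_prod) (use \<open>finite J\<close> in auto)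
    also have "\<dots> = (\<Prod>j\<in>J. emeasure (density M f) (A j))"
      by (intro prod.cong) (auto simp: emeasure_density)
    finally show "emeasure (density (PiM J (\<lambda>_. M)) (\<lambda>y. \<Prod>j\<in>J. f (y j))) (Pi\<^sub>E J A)
        = (\<Prod>j\<in>J. emeasure (density M f) (A j))" .
  qed
qed

section \<open>Conditional means on the space of iid sequences\<close>

locale iid_space = prob_space M for M :: "'a measure" +
  assumes space_UNIV: "space M = UNIV"
begin

sublocale seq: prob_space "iid M"
  by (intro prob_space_PiM prob_space_axioms)

sublocale seq2: pair_prob_space "iid M" "iid M" ..

lemma space_iid: "space (iid M) = UNIV"
  by (simp add: space_PiM space_UNIV)

text \<open>The bound holds everywhere and no law is mentioned, so the same class serves the two
  laws \<open>Q\<close> and \<open>P\<close> below and gives integrability under both.\<close>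

definition bmeas :: "((nat \<Rightarrow> 'a) \<Rightarrow> real) \<Rightarrow> bool" where
  "bmeas h \<longleftrightarrow> h \<in> borel_measurable (iid M) \<and> (\<exists>B. \<forall>y. \<bar>h y\<bar> \<le> B)"

lemma bmeasI: "h \<in> borel_measurable (iid M) \<Longrightarrow> (\<And>y. \<bar>h y\<bar> \<le> B) \<Longrightarrow> bmeas h"
  by (auto simp: bmeas_def)

lemma bmeas_measurable: "bmeas h \<Longrightarrow> h \<in> borel_measurable (iid M)"
  by (simp add: bmeas_def)

lemma bmeas_integrable: "bmeas h \<Longrightarrow> integrable (iid M) h"
  unfolding bmeas_def using seq.integrable_const_bound[of h] by (auto intro: AE_I2)

lemma bmeas_const: "bmeas (\<lambda>_. c)"
  by (rule bmeasI[of _ "\<bar>c\<bar>"]) auto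

lemma bmeas_add: "bmeas f \<Longrightarrow> bmeas g \<Longrightarrow> bmeas (\<lambda>y. f y + g y)"
  unfolding bmeas_def
proof (elim conjE exE, intro conjI exI allI)
  fix B C y assume "\<forall>y. \<bar>f y\<bar> \<le> B" "\<forall>y. \<bar>g y\<bar> \<le> C"
  then show "\<bar>f y + g y\<bar> \<le> B + C"
    by (metis abs_triangle_ineq add_mono order_trans)
qed auto

lemma bmeas_mult: "bmeas f \<Longrightarrow> bmeas g \<Longrightarrow> bmeas (\<lambda>y. f y * g y)"
  unfolding bmeas_def
proof (elim conjE exE, intro conjI exI allI)
  fix B C y assume "\<forall>y. \<bar>f y\<bar> \<le> B" "\<forall>y. \<bar>g y\<bar> \<le> C"
  then show "\<bar>f y * g y\<bar> \<le> B * C"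
    unfolding abs_mult by (intro mult_mono) (auto intro: order_trans[OF abs_ge_zero])
qed auto

lemma bmeas_diff: "bmeas f \<Longrightarrow> bmeas g \<Longrightarrow> bmeas (\<lambda>y. f y - g y)"
  using bmeas_add[OF _ bmeas_mult[OF bmeas_const[of "-1"]], of f g] by simp

lemma bmeas_sum: "finite A \<Longrightarrow> (\<And>a. a \<in> A \<Longrightarrow> bmeas (f a)) \<Longrightarrow> bmeas (\<lambda>y. \<Sum>a\<in>A. f a y)"
  by (induction rule: finite_induct) (auto intro: bmeas_const bmeas_add)

lemma bmeas_prod: "finite A \<Longrightarrow> (\<And>a. a \<in> A \<Longrightarrow> bmeas (f a)) \<Longrightarrow> bmeas (\<lambda>y. \<Prod>a\<in>A. f a y)"
  by (induction rule: finite_induct) (auto intro: bmeas_const bmeas_mult)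

lemma bmeas_power2: "bmeas f \<Longrightarrow> bmeas (\<lambda>y. (f y)\<^sup>2)"
  unfolding power2_eq_square by (rule bmeas_mult)

lemmas bmeas_intros = bmeas_const bmeas_add bmeas_diff bmeas_mult bmeas_sum bmeas_prod bmeas_power2

lemma bmeas_comp:
  assumes "bmeas h" "\<phi> \<in> measurable (iid M) (iid M)"
  shows "bmeas (\<lambda>y. h (\<phi> y))"
  using assms by (auto simp: bmeas_def)

lemma measurable_reindex: "(\<lambda>y k. y (\<rho> k)) \<in> measurable (iid M) (iid M)"
  by (intro measurable_iidI space_UNIV) simp

lemma measurable_splice_snd: "splice_at S y \<in> measurable (iid M) (iid M)"
  using measurable_compose[OF measurable_Pair1' measurable_splice_at[OF space_UNIV], of y]
  by (simp add: space_iid)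

lemma integral_reindex:
  assumes "bmeas h" "inj \<rho>"
  shows "(\<integral>y. h (\<lambda>k. y (\<rho> k)) \<partial>iid M) = (\<integral>y. h y \<partial>iid M)"
  by (subst (2) distr_iid_reindex[OF prob_space_axioms assms(2), symmetric], subst integral_distr)
     (auto intro: measurable_reindex bmeas_measurable assms)

lemma integral_splice:
  assumes "bmeas h"
  shows "(\<integral>y. h y \<partial>iid M) = (\<integral>y. \<integral>z. h (splice_at S y z) \<partial>iid M \<partial>iid M)"
proof -
  note m = bmeas_measurable[OF assms] measurable_splice_at[OF space_UNIV, of S]
  obtain B where "\<And>y. \<bar>h y\<bar> \<le> B" using assms by (auto simp: bmeas_def)
  then have "integrable (iid M \<Otimes>\<^sub>M iid M) (\<lambda>p. h (splice_at S (fst p) (snd p)))"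
    using measurable_compose[OF m(2) m(1)] by (intro seq2.integrable_const_bound[of _ B]) auto
  from seq2.integral_fst'[OF this]
  have "(\<integral>y. \<integral>z. h (splice_at S y z) \<partial>iid M \<partial>iid M)
      = (\<integral>p. h (splice_at S (fst p) (snd p)) \<partial>(iid M \<Otimes>\<^sub>M iid M))" by simp
  also have "\<dots> = (\<integral>y. h y \<partial>distr (iid M \<Otimes>\<^sub>M iid M) (iid M) (\<lambda>p. splice_at S (fst p) (snd p)))"
    by (subst integral_distr) (use m in auto)
  finally show ?thesis
    by (simp add: distr_iid_splice_at[OF prob_space_axioms space_UNIV])
qed

text \<open>Conditional expectation of \<open>f\<close> given the coordinates in \<open>S\<close>.\<close>

definition cond :: "nat set \<Rightarrow> ((nat \<Rightarrow> 'a) \<Rightarrow> real) \<Rightarrow> (nat \<Rightarrow> 'a) \<Rightarrow> real" where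
  "cond S f y = (\<integral>z. f (splice_at S y z) \<partial>iid M)"

lemma bmeas_splice: "bmeas f \<Longrightarrow> bmeas (\<lambda>z. f (splice_at S y z))"
  using bmeas_comp measurable_splice_snd by blast

lemma bmeas_cond: assumes "bmeas f" shows "bmeas (cond S f)"
proof -
  obtain B where B: "\<And>y. \<bar>f y\<bar> \<le> B" using assms by (auto simp: bmeas_def)
  show ?thesis
  proof (rule bmeasI)
    have "(\<lambda>(y, z). f (splice_at S y z)) \<in> borel_measurable (iid M \<Otimes>\<^sub>M iid M)"
      using measurable_compose[OF measurable_splice_at[OF space_UNIV] bmeas_measurable[OF assms]]
      by (simp add: case_prod_beta)
    then show "cond S f \<in> borel_measurable (iid M)"
      unfolding cond_def by (rule seq.borel_measurable_lebesgue_integral)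
    fix y
    have "norm (cond S f y) \<le> (\<integral>z. norm (f (splice_at S y z)) \<partial>iid M)"
      unfolding cond_def by (rule integral_norm_bound)
    also have "\<dots> \<le> (\<integral>z. B \<partial>iid M)"
      using B bmeas_integrable[OF bmeas_splice[OF assms, of S y]]
      by (intro integral_mono) auto
    finally show "\<bar>cond S f y\<bar> \<le> B" by (simp add: seq.prob_space)
  qed
qed

lemma cond_diff:
  "bmeas f \<Longrightarrow> bmeas g \<Longrightarrow> cond S (\<lambda>y. f y - g y) = (\<lambda>y. cond S f y - cond S g y)"
  by (auto simp: cond_def bmeas_integrable bmeas_splice)

text \<open>Valid for sets that are not nested, by independence: resampling off \<open>T\<close> and
  then off \<open>S\<close> resamples everything off \<open>S \<inter> T\<close>.\<close>

lemma cond_cond: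
  assumes "bmeas f"
  shows "cond S (cond T f) = cond (S \<inter> T) f"
proof
  fix y
  have "splice_at T (splice_at S y z) z' = splice_at (S \<inter> T) y (splice_at T z z')" for z z' :: "nat \<Rightarrow> 'a"
    by (auto simp: splice_at_def)
  then show "cond S (cond T f) y = cond (S \<inter> T) f y"
    using integral_splice[OF bmeas_splice[OF assms, of "S \<inter> T" y], of T] by (simp add: cond_def)
qed

lemma cond_splice: "cond S f (splice_at S y z) = cond S f y"
proof -
  have "splice_at S (splice_at S y z) z' = splice_at S y z'" for z'
    by (auto simp: splice_at_def)
  then show ?thesis by (simp add: cond_def)
qed

text \<open>\<open>cond S\<close> is an orthogonal projection: \<open>cond S f\<close> is constant
  in the resampled coordinates and leaves the inner integral.\<close>

lemma integral_cond_mult: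
  assumes "bmeas f" "bmeas g"
  shows "(\<integral>y. cond S f y * g y \<partial>iid M) = (\<integral>y. cond S f y * cond S g y \<partial>iid M)"
  by (subst integral_splice[where S=S])
     (simp_all add: bmeas_mult bmeas_cond assms cond_splice, simp add: cond_def)

lemma integral_cond_cond:
  assumes "bmeas f" "S \<subseteq> T"
  shows "(\<integral>y. cond S f y * cond T f y \<partial>iid M) = (\<integral>y. (cond S f y)\<^sup>2 \<partial>iid M)"
  using integral_cond_mult[OF assms(1) bmeas_cond[OF assms(1), of T], of S] assms
  by (simp add: cond_cond Int_absorb2 power2_eq_square)

lemma integral_cond_contract:
  assumes "bmeas f"
  shows "(\<integral>y. (cond S f y)\<^sup>2 \<partial>iid M) \<le> (\<integral>y. (f y)\<^sup>2 \<partial>iid M)"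
proof -
  have "0 \<le> (\<integral>y. (f y - cond S f y)\<^sup>2 \<partial>iid M)" by simp
  also have "\<dots> = (\<integral>y. (f y)\<^sup>2 - 2 * (cond S f y * f y) + (cond S f y)\<^sup>2 \<partial>iid M)"
    by (simp add: power2_diff algebra_simps)
  also have "\<dots> = (\<integral>y. (f y)\<^sup>2 \<partial>iid M) - 2 * (\<integral>y. cond S f y * f y \<partial>iid M) + (\<integral>y. (cond S f y)\<^sup>2 \<partial>iid M)"
    by (simp add: bmeas_integrable bmeas_intros bmeas_cond assms)
  finally show ?thesis
    by (simp add: integral_cond_mult assms power2_eq_square)
qed

section \<open>Energy: the second moment explained by a set of coordinates\<close>

definition energy :: "((nat \<Rightarrow> 'a) \<Rightarrow> real) \<Rightarrow> nat set \<Rightarrow> real" where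
  "energy f S = (\<integral>y. (cond S f y)\<^sup>2 \<partial>iid M)"

lemma energy_diff:
  assumes "bmeas f" "S \<subseteq> T"
  shows "(\<integral>y. (cond T f y - cond S f y)\<^sup>2 \<partial>iid M) = energy f T - energy f S"
proof -
  have "(\<integral>y. (cond T f y - cond S f y)\<^sup>2 \<partial>iid M)
      = (\<integral>y. (cond T f y)\<^sup>2 - 2 * (cond S f y * cond T f y) + (cond S f y)\<^sup>2 \<partial>iid M)"
    by (simp add: power2_diff algebra_simps)
  also have "\<dots> = energy f T - 2 * (\<integral>y. cond S f y * cond T f y \<partial>iid M) + energy f S"
    by (simp add: energy_def bmeas_integrable bmeas_intros bmeas_cond assms)
  finally show ?thesis
    by (simp add: integral_cond_cond assms energy_def)
qed

lemma energy_mono: "bmeas f \<Longrightarrow> S \<subseteq> T \<Longrightarrow> energy f S \<le> energy f T"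
  using energy_diff[of f S T] Bochner_Integration.integral_nonneg[of "iid M" "\<lambda>y. (cond T f y - cond S f y)\<^sup>2"] by simp

text \<open>The martingale increment over \<open>R\<close> is the projection by
  \<open>cond (insert k R)\<close> of the increment over \<open>T\<close>, and projections
  contract.\<close>

lemma energy_supermodular:
  assumes "bmeas f" "R \<subseteq> T" "k \<notin> T"
  shows "energy f (insert k R) - energy f R \<le> energy f (insert k T) - energy f T"
proof -
  let ?h = "\<lambda>y. cond (insert k T) f y - cond T f y"
  have h: "bmeas ?h" by (intro bmeas_intros bmeas_cond assms)
  have "insert k R \<inter> insert k T = insert k R" "insert k R \<inter> T = R"
    using assms by auto
  then have "cond (insert k R) ?h = (\<lambda>y. cond (insert k R) f y - cond R f y)"
    by (simp add: cond_diff bmeas_cond assms cond_cond)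
  then have "energy f (insert k R) - energy f R = (\<integral>y. (cond (insert k R) ?h y)\<^sup>2 \<partial>iid M)"
    using energy_diff[OF assms(1), of R "insert k R", OF subset_insertI] by simp
  also have "\<dots> \<le> (\<integral>y. (?h y)\<^sup>2 \<partial>iid M)"
    by (rule integral_cond_contract[OF h])
  also have "\<dots> = energy f (insert k T) - energy f T"
    by (intro energy_diff assms) auto
  finally show ?thesis .
qed

lemma energy_empty: "energy f {} = (\<integral>y. f y \<partial>iid M)\<^sup>2"
proof -
  have "splice_at {} y z = z" for y z :: "nat \<Rightarrow> 'a" by (auto simp: splice_at_def)
  then show ?thesis by (simp add: energy_def cond_def seq.prob_space)
qed

lemma energy_full:
  assumes "depends_on J f"
  shows "energy f J = (\<integral>y. (f y)\<^sup>2 \<partial>iid M)"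
proof -
  have "f (splice_at J y z) = f y" for y z
    by (rule depends_onD[OF assms]) (auto simp: splice_at_def)
  then show ?thesis by (simp add: energy_def cond_def seq.prob_space)
qed

text \<open>If \<open>S\<close> is built up in increasing order, \<open>k\<close> joins a subset of
  \<open>{..<k}\<close>, so by supermodularity it gains at most what it gains after all of
  \<open>{..<k}\<close>.\<close>

lemma energy_le_chain:
  assumes "bmeas f" "S \<subseteq> {..<n}"
  shows "energy f S \<le> energy f {} + (\<Sum>k\<in>S. energy f {..<Suc k} - energy f {..<k})"
  using assms(2)
proof (induction n arbitrary: S)
  case (Suc n)
  show ?case
  proof (cases "n \<in> S")
    case True
    define R where "R = S - {n}"
    have R: "R \<subseteq> {..<n}" "S = insert n R" "n \<notin> R" "finite R"
      using Suc.prems True by (auto simp: R_def less_Suc_eq intro: finite_subset)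
    have "energy f S - energy f R \<le> energy f {..<Suc n} - energy f {..<n}"
      using energy_supermodular[OF assms(1) R(1), of n] by (simp add: R(2) lessThan_Suc)
    with Suc.IH[OF R(1)] show ?thesis using R by simp
  next
    case False
    with Suc.prems have "S \<subseteq> {..<n}" by (auto simp: less_Suc_eq)
    then show ?thesis by (rule Suc.IH)
  qed
qed auto

text \<open>The gains along the full chain telescope to the variance of \<open>f\<close>, and each
  gain is charged by at most a fraction \<open>p\<close> of the sets.\<close>

lemma sum_energy_le:
  assumes f: "bmeas f" "depends_on {..<n} f" and A: "finite A"
    and S: "\<And>a. a \<in> A \<Longrightarrow> S a \<subseteq> {..<n}"
    and p: "\<And>k. k < n \<Longrightarrow> real (card {a \<in> A. k \<in> S a}) \<le> p * real (card A)"
  shows "(\<Sum>a\<in>A. energy f (S a))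
      \<le> real (card A) * ((\<integral>y. f y \<partial>iid M)\<^sup>2 + p * ((\<integral>y. (f y)\<^sup>2 \<partial>iid M) - (\<integral>y. f y \<partial>iid M)\<^sup>2))"
proof -
  define d where "d k = energy f {..<Suc k} - energy f {..<k}" for k
  have d: "d k \<ge> 0" for k
    using energy_mono[OF f(1), of "{..<k}" "{..<Suc k}"] by (auto simp: d_def)
  have tot: "(\<Sum>k<n. d k) = (\<integral>y. (f y)\<^sup>2 \<partial>iid M) - (\<integral>y. f y \<partial>iid M)\<^sup>2"
    using sum_lessThan_telescope[of "\<lambda>k. energy f {..<k}" n]
    by (simp add: d_def energy_full[OF f(2)] energy_empty)
  have "(\<Sum>a\<in>A. energy f (S a)) \<le> (\<Sum>a\<in>A. energy f {} + (\<Sum>k\<in>S a. d k))"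
    unfolding d_def by (intro sum_mono energy_le_chain[where n=n] f S)
  also have "\<dots> = real (card A) * energy f {} + (\<Sum>a\<in>A. \<Sum>k\<in>S a. d k)"
    by (simp add: sum.distrib)
  also have "(\<Sum>a\<in>A. \<Sum>k\<in>S a. d k) = (\<Sum>a\<in>A. \<Sum>k<n. if k \<in> S a then d k else 0)"
  proof (rule sum.cong[OF refl])
    fix a assume "a \<in> A"
    from S[OF this] have "{k \<in> {..<n}. k \<in> S a} = S a" by auto
    then show "(\<Sum>k\<in>S a. d k) = (\<Sum>k<n. if k \<in> S a then d k else 0)"
      by (simp add: sum.inter_filter[symmetric])
  qed
  also have "\<dots> = (\<Sum>k<n. \<Sum>a\<in>A. if k \<in> S a then d k else 0)"
    by (rule sum.swap)
  also have "\<dots> = (\<Sum>k<n. real (card {a \<in> A. k \<in> S a}) * d k)"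
    using A by (simp add: sum.inter_filter[symmetric])
  also have "\<dots> \<le> (\<Sum>k<n. p * real (card A) * d k)"
    by (intro sum_mono mult_right_mono p d) auto
  also have "\<dots> = p * real (card A) * (\<Sum>k<n. d k)"
    by (simp add: sum_distrib_left)
  finally show ?thesis
    by (simp add: tot energy_empty algebra_simps)
qed

end

section \<open>Signs, logarithm estimates and linear codes\<close>

lemma bpsk_simps [simp]:
  "bpsk False = 1" "bpsk True = -1" "bpsk b * bpsk b = 1" "\<bar>bpsk b\<bar> = 1"
  by (auto simp: bpsk_def)

lemma bpsk_neq: "bpsk (a \<noteq> b) = bpsk a * bpsk b" "bpsk (a = (\<not> b)) = bpsk a * bpsk b"
  by (auto simp: bpsk_def)

text \<open>The two sides come from \<open>ln t \<le> t - 1\<close> at \<open>x\<close> and at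
  \<open>1 / x\<close>. It keeps entropy integrands bounded.\<close>

lemma abs_mult_ln_le:
  fixes x :: real
  assumes "0 \<le> x"
  shows "\<bar>x * ln x\<bar> \<le> 1 + x\<^sup>2"
proof (cases "x = 0")
  case False
  with assms have x: "x > 0" by simp
  have "x * ln x \<le> x * (x - 1)"
    using ln_le_minus_one[OF x] x by (intro mult_left_mono) auto
  moreover have "x * ln (1 / x) \<le> x * (1 / x - 1)"
    using ln_le_minus_one[of "1 / x"] x by (intro mult_left_mono) auto
  ultimately have "x * ln x \<le> x\<^sup>2 - x" "- (x * ln x) \<le> 1 - x"
    using x by (simp_all add: ln_div algebra_simps power2_eq_square)
  then show ?thesis
    using x zero_le_power2[of x] unfolding abs_le_iff by linarith
qed auto

text \<open>The linear term will average out, and the quadratic one turns information into a squared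
  estimate.\<close>

lemma mult_ln_one_plus_le:
  fixes s :: real
  assumes "-1 \<le> s"
  shows "(1 + s) * ln (1 + s) \<le> s + s\<^sup>2"
proof (cases "s = -1")
  case False
  with assms have "ln (1 + s) \<le> s" using ln_le_minus_one[of "1 + s"] by simp
  then have "(1 + s) * ln (1 + s) \<le> (1 + s) * s"
    using assms by (intro mult_left_mono) auto
  then show ?thesis by (simp add: algebra_simps power2_eq_square)
qed simp

definition linear_code :: "(nat \<Rightarrow> bool) set \<Rightarrow> bool" where
  "linear_code C \<longleftrightarrow> finite C \<and> C \<noteq> {} \<and> (\<forall>u\<in>C. \<forall>v\<in>C. (\<lambda>k. u k \<noteq> v k) \<in> C)"

lemma sum_linear_code_shift:
  assumes "linear_code C" "u \<in> C"
  shows "(\<Sum>v\<in>C. F (\<lambda>k. u k \<noteq> v k)) = (\<Sum>v\<in>C. F v)"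
  using assms unfolding linear_code_def
  by (intro sum.reindex_bij_witness[of _ "\<lambda>v k. u k \<noteq> v k" "\<lambda>v k. u k \<noteq> v k"]) auto

section \<open>Symmetric channels and the extrinsic estimate of a code bit\<close>

text \<open>\<open>Q\<close> is the law of the channel output under uniform input, and the output \<open>y\<close> has
  density \<open>1 + x * \<psi> y\<close> with respect to \<open>Q\<close> when \<open>x = \<plusminus>1\<close> is sent; \<open>\<sigma>\<close> is the symmetry that
  exchanges the two inputs.\<close>

locale symmetric_channel = iid_space Q for Q :: "'a measure" +
  fixes \<psi> :: "'a \<Rightarrow> real" and \<sigma> :: "'a \<Rightarrow> 'a"
  assumes psi_meas [measurable]: "\<psi> \<in> borel_measurable Q"
    and psi_bound: "\<And>y. \<bar>\<psi> y\<bar> \<le> 1"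
    and sigma_meas [measurable]: "\<sigma> \<in> measurable Q Q"
    and sigma_inv: "distr Q Q \<sigma> = Q"
    and psi_sigma: "\<And>y. \<psi> (\<sigma> y) = - \<psi> y"
begin

lemma psi_ge: "0 \<le> 1 + \<psi> y" and psi_le: "\<psi> y \<le> 1"
  using psi_bound[of y] by (auto simp: abs_le_iff)

lemma integrable_psi: "integrable Q \<psi>"
  using psi_bound by (intro integrable_const_bound[of _ 1]) auto

lemma integral_psi: "(\<integral>y. \<psi> y \<partial>Q) = 0"
proof -
  have "(\<integral>y. \<psi> y \<partial>Q) = (\<integral>y. \<psi> y \<partial>distr Q Q \<sigma>)" by (simp only: sigma_inv)
  also have "\<dots> = (\<integral>y. \<psi> (\<sigma> y) \<partial>Q)" by (rule integral_distr) measurable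
  finally show ?thesis by (simp add: psi_sigma)
qed

text \<open>The output law for input \<open>+1\<close>, that is, for a code bit
  \<open>False\<close>.\<close>

definition P :: "'a measure" where
  "P = density Q (\<lambda>y. ennreal (1 + \<psi> y))"

lemma sets_P [measurable_cong]: "sets P = sets Q" by (simp add: P_def)

sublocale one: iid_space P
proof (intro iid_space.intro prob_spaceI iid_space_axioms.intro)
  show "emeasure P (space P) = 1"
    by (simp add: P_def emeasure_density nn_integral_eq_integral integrable_psi psi_ge
        integral_psi prob_space cong: nn_integral_cong)
  show "space P = UNIV" by (simp add: P_def space_UNIV)
qed

lemma sets_iid_P: "sets (iid P) = sets (iid Q)"
  by (intro sets_PiM_cong) (auto simp: sets_P)

lemma one_bmeas [simp]: "one.bmeas h \<longleftrightarrow> bmeas h"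
  unfolding one.bmeas_def bmeas_def
  by (simp add: measurable_cong_sets[OF sets_iid_P refl])

definition flip :: "(nat \<Rightarrow> bool) \<Rightarrow> (nat \<Rightarrow> 'a) \<Rightarrow> nat \<Rightarrow> 'a" where
  "flip v y = (\<lambda>k. if v k then \<sigma> (y k) else y k)"

lemma psi_flip: "\<psi> (flip v y k) = bpsk (v k) * \<psi> (y k)"
  by (auto simp: flip_def psi_sigma)

lemma measurable_flip: "flip v \<in> measurable (iid Q) (iid Q)"
  by (intro measurable_iidI space_UNIV) (auto simp: flip_def)

lemma integral_flip:
  assumes "bmeas h"
  shows "(\<integral>y. h (flip v y) \<partial>iid Q) = (\<integral>y. h y \<partial>iid Q)"
proof -
  have "distr (iid Q) (iid Q) (\<lambda>y k. (if v k then \<sigma> else (\<lambda>x. x)) (y k)) = iid Q"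
    by (rule distr_iid_map[OF prob_space_axioms space_UNIV]) (auto simp: sigma_inv distr_id[unfolded id_def])
  moreover have "(\<lambda>y k. (if v k then \<sigma> else (\<lambda>x. x)) (y k)) = flip v"
    by (auto simp: flip_def fun_eq_iff)
  ultimately have "(\<integral>y. h y \<partial>iid Q) = (\<integral>y. h y \<partial>distr (iid Q) (iid Q) (flip v))" by simp
  also have "\<dots> = (\<integral>y. h (flip v y) \<partial>iid Q)"
    by (rule integral_distr[OF measurable_flip bmeas_measurable[OF assms]])
  finally show ?thesis ..
qed

lemma bmeas_psi: "bmeas (\<lambda>y. \<psi> (y k))"
  by (rule bmeasI[of _ 1]) (auto simp: psi_bound)

text \<open>Flipping output \<open>k\<close> alone preserves the law and \<open>h\<close> but
  negates \<open>\<psi> (y k)\<close>.\<close>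

lemma integral_mult_psi:
  assumes "bmeas h" "depends_on J h" "k \<notin> J"
  shows "(\<integral>y. h y * \<psi> (y k) \<partial>iid Q) = 0"
proof -
  have "h (flip (\<lambda>j. j = k) y) = h y" for y
    by (rule depends_onD[OF assms(2)]) (use assms(3) in \<open>auto simp: flip_def\<close>)
  then have "(\<integral>y. h y * \<psi> (y k) \<partial>iid Q) = (\<integral>y. - (h y * \<psi> (y k)) \<partial>iid Q)"
    by (subst integral_flip[where v="\<lambda>j. j = k", symmetric])
       (auto intro!: bmeas_mult bmeas_psi assms simp: psi_flip)
  then show ?thesis by simp
qed

text \<open>Density, relative to \<open>iid Q\<close>, of the outputs in \<open>J\<close> when
  \<open>v\<close> is sent.\<close>

definition lik :: "nat set \<Rightarrow> (nat \<Rightarrow> bool) \<Rightarrow> (nat \<Rightarrow> 'a) \<Rightarrow> real" where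
  "lik J v y = (\<Prod>k\<in>J. 1 + bpsk (v k) * \<psi> (y k))"

lemma lik_factor_nonneg: "0 \<le> 1 + bpsk b * \<psi> y"
  using psi_bound[of y] by (auto simp: bpsk_def abs_le_iff)

lemma lik_nonneg: "0 \<le> lik J v y"
  unfolding lik_def by (intro prod_nonneg lik_factor_nonneg ballI)

lemma bmeas_lik: "finite J \<Longrightarrow> bmeas (lik J v)"
  unfolding lik_def by (intro bmeas_intros bmeas_psi)

lemma lik_flip: "lik J v (flip u y) = lik J (\<lambda>k. u k \<noteq> v k) y"
  by (simp add: lik_def psi_flip bpsk_neq mult.left_commute mult.assoc)

lemma lik_cong: "(\<And>k. k \<in> J \<Longrightarrow> y k = z k) \<Longrightarrow> lik J v y = lik J v z"
  by (auto simp: lik_def)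

lemma integral_iid_P:
  assumes J: "finite J" and h: "bmeas h" "depends_on J h"
  shows "(\<integral>y. h y \<partial>iid P) = (\<integral>y. h y * lik J (\<lambda>_. False) y \<partial>iid Q)"
proof -
  let ?L = "lik J (\<lambda>_. False)"
  have hL: "bmeas (\<lambda>y. h y * ?L y)" by (intro bmeas_mult h bmeas_lik J)
  have dep: "depends_on J (\<lambda>y. h y * ?L y)"
    unfolding depends_on_def by (intro allI impI arg_cong2[of _ _ _ _ "(*)"] depends_onD[OF h(2)] lik_cong) auto
  have L: "(\<Prod>j\<in>J. ennreal (1 + \<psi> (y j))) = ennreal (?L y)" for y
    by (simp add: lik_def prod_ennreal psi_ge)
  have P: "PiM J (\<lambda>_. P) = density (PiM J (\<lambda>_. Q)) (\<lambda>y. ennreal (?L y))"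
    unfolding L[symmetric] P_def
    by (rule PiM_density) (auto simp: P_def[symmetric] J sigma_finite_measure_axioms one.prob_space_axioms)
  have hP: "h \<in> borel_measurable (iid P)"
    using h(1) by (simp add: bmeas_def measurable_cong_sets[OF sets_iid_P refl])
  have "(\<integral>y. h y \<partial>iid P) = (\<integral>y. h y \<partial>PiM J (\<lambda>_. P))"
    by (rule integral_iid_depends_on[OF one.prob_space_axioms one.space_UNIV J hP h(2)])
  also have "\<dots> = (\<integral>y. ?L y * h y \<partial>PiM J (\<lambda>_. Q))"
    unfolding P
  proof (rule integral_real_density)
    show "h \<in> borel_measurable (PiM J (\<lambda>_. Q))"
      by (rule measurable_depends_on[OF bmeas_measurable[OF h(1)] h(2) space_UNIV])
    show "?L \<in> borel_measurable (PiM J (\<lambda>_. Q))"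
      by (rule measurable_depends_on[OF bmeas_measurable[OF bmeas_lik[OF J]] _ space_UNIV])
         (auto simp: depends_on_def intro: lik_cong)
  qed (simp add: lik_nonneg)
  also have "\<dots> = (\<integral>y. h y * ?L y \<partial>iid Q)"
    by (subst integral_iid_depends_on[OF prob_space_axioms space_UNIV J bmeas_measurable[OF hL] dep])
       (simp add: mult.commute)
  finally show ?thesis .
qed

text \<open>Density of the outputs in \<open>J\<close> under a uniformly random codeword;
  \<open>num\<close> weights it by the sign of bit \<open>b\<close>.\<close>

definition den :: "(nat \<Rightarrow> bool) set \<Rightarrow> nat set \<Rightarrow> (nat \<Rightarrow> 'a) \<Rightarrow> real" where
  "den C J y = (\<Sum>v\<in>C. lik J v y) / real (card C)"

definition num :: "(nat \<Rightarrow> bool) set \<Rightarrow> nat set \<Rightarrow> nat \<Rightarrow> (nat \<Rightarrow> 'a) \<Rightarrow> real" where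
  "num C J b y = (\<Sum>v\<in>C. bpsk (v b) * lik J v y) / real (card C)"

text \<open>The conditional mean of bit \<open>b\<close> given the outputs in the positions \<open>J\<close>; where \<open>den\<close>
  vanishes so does \<open>num\<close>, and the estimate is \<open>0\<close>.\<close>

definition est :: "(nat \<Rightarrow> bool) set \<Rightarrow> nat set \<Rightarrow> nat \<Rightarrow> (nat \<Rightarrow> 'a) \<Rightarrow> real" where
  "est C J b y = num C J b y / den C J y"

text \<open>One minus the mean squared error of the estimate, by orthogonality. By symmetry the
  expectation may be taken under the all-zero codeword, whose outputs have the law \<open>iid P\<close>.\<close>

definition quality :: "(nat \<Rightarrow> bool) set \<Rightarrow> nat set \<Rightarrow> nat \<Rightarrow> real" where
  "quality C J b = (\<integral>y. (est C J b y)\<^sup>2 \<partial>iid P)"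

text \<open>Equivariance under the flips that permute the codewords: such a \<open>g\<close> has the
  same correlation with bit \<open>b\<close> whichever codeword is sent.\<close>

definition odd_fun :: "(nat \<Rightarrow> bool) set \<Rightarrow> nat \<Rightarrow> ((nat \<Rightarrow> 'a) \<Rightarrow> real) \<Rightarrow> bool" where
  "odd_fun C b g \<longleftrightarrow> (\<forall>u\<in>C. \<forall>y. g (flip u y) = bpsk (u b) * g y)"

lemma den_nonneg: "0 \<le> den C J y"
  unfolding den_def by (intro divide_nonneg_nonneg sum_nonneg lik_nonneg) auto

lemma abs_num_le: "\<bar>num C J b y\<bar> \<le> den C J y"
proof -
  have "\<bar>\<Sum>v\<in>C. bpsk (v b) * lik J v y\<bar> \<le> (\<Sum>v\<in>C. lik J v y)"
    by (rule order_trans[OF sum_abs]) (simp add: abs_mult lik_nonneg)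
  then show ?thesis
    unfolding num_def den_def by (simp add: divide_right_mono)
qed

lemma est_mult_den: "est C J b y * den C J y = num C J b y"
  using abs_num_le[of C J b y] by (auto simp: est_def)

lemma abs_est_le: "\<bar>est C J b y\<bar> \<le> 1"
  using abs_num_le[of C J b y] den_nonneg[of C J y] by (auto simp: est_def divide_le_eq_1)

lemma bmeas_den: "finite C \<Longrightarrow> finite J \<Longrightarrow> bmeas (den C J)"
  unfolding den_def divide_inverse by (intro bmeas_intros bmeas_lik)

lemma bmeas_num: "finite C \<Longrightarrow> finite J \<Longrightarrow> bmeas (num C J b)"
  unfolding num_def divide_inverse by (intro bmeas_intros bmeas_lik)

lemma bmeas_est: "finite C \<Longrightarrow> finite J \<Longrightarrow> bmeas (est C J b)"
  using bmeas_measurable[OF bmeas_den[of C J]] bmeas_measurable[OF bmeas_num[of C J b]]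
  by (intro bmeasI[of _ 1]) (simp_all only: abs_est_le, simp add: est_def[abs_def])

lemma den_cong: "(\<And>k. k \<in> J \<Longrightarrow> y k = z k) \<Longrightarrow> den C J y = den C J z"
  unfolding den_def using lik_cong[of J y z] by simp

lemma num_cong: "(\<And>k. k \<in> J \<Longrightarrow> y k = z k) \<Longrightarrow> num C J b y = num C J b z"
  unfolding num_def using lik_cong[of J y z] by simp

lemma depends_on_est: "J \<subseteq> J' \<Longrightarrow> depends_on J' (est C J b)"
  unfolding depends_on_def est_def using den_cong[of J] num_cong[of J] by (metis subsetD)

lemma odd_fun_est:
  assumes "linear_code C"
  shows "odd_fun C b (est C J b)"
proof -
  { fix u y assume u: "u \<in> C"
    have "(\<Sum>v\<in>C. bpsk (v b) * lik J v (flip u y))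
        = bpsk (u b) * (\<Sum>v\<in>C. bpsk (u b \<noteq> v b) * lik J (\<lambda>k. u k \<noteq> v k) y)"
      unfolding sum_distrib_left by (rule sum.cong[OF refl]) (auto simp: lik_flip bpsk_def)
    also have "\<dots> = bpsk (u b) * (\<Sum>v\<in>C. bpsk (v b) * lik J v y)"
      using sum_linear_code_shift[OF assms u, of "\<lambda>v. bpsk (v b) * lik J v y"] by simp
    finally have "num C J b (flip u y) = bpsk (u b) * num C J b y"
      by (simp add: num_def)
    moreover have "den C J (flip u y) = den C J y"
      using sum_linear_code_shift[OF assms u, of "\<lambda>v. lik J v y"] by (simp add: den_def lik_flip)
    ultimately have "est C J b (flip u y) = bpsk (u b) * est C J b y"
      by (simp add: est_def) }
  then show ?thesis by (simp add: odd_fun_def)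
qed

text \<open>Flipping along \<open>u\<close> replaces the zero word by \<open>u\<close> at the price
  of the sign of \<open>u b\<close>. Averaging this identity over the code produces
  \<open>num\<close>.\<close>

lemma integral_odd_fun:
  assumes C: "linear_code C" and J: "finite J" and g: "bmeas g" "depends_on J g" "odd_fun C b g"
  shows "(\<integral>y. g y \<partial>iid P) = (\<integral>y. g y * num C J b y \<partial>iid Q)"
proof -
  have fin: "finite C" "card C > 0" "C \<noteq> {}" using C by (auto simp: linear_code_def card_gt_0_iff)
  have "(\<integral>y. g y \<partial>iid P) = (\<integral>y. g y * (bpsk (u b) * lik J u y) \<partial>iid Q)" if u: "u \<in> C" for u
  proof -
    have "(\<integral>y. g y \<partial>iid P) = (\<integral>y. g y * lik J (\<lambda>_. False) y \<partial>iid Q)"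
      by (rule integral_iid_P[OF J g(1,2)])
    also have "\<dots> = (\<integral>y. g (flip u y) * lik J (\<lambda>_. False) (flip u y) \<partial>iid Q)"
      by (rule integral_flip[symmetric]) (intro bmeas_mult g bmeas_lik J)
    also have "\<dots> = (\<integral>y. g y * (bpsk (u b) * lik J u y) \<partial>iid Q)"
      using g(3) u by (simp add: odd_fun_def lik_flip mult_ac)
    finally show ?thesis .
  qed
  then have "(\<Sum>u\<in>C. \<integral>y. g y \<partial>iid P) = (\<Sum>u\<in>C. \<integral>y. g y * (bpsk (u b) * lik J u y) \<partial>iid Q)"
    by (rule sum.cong[OF refl])
  then have "real (card C) * (\<integral>y. g y \<partial>iid P) = (\<Sum>u\<in>C. \<integral>y. g y * (bpsk (u b) * lik J u y) \<partial>iid Q)"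
    by (simp only: sum_constant)
  also have "\<dots> = (\<integral>y. (\<Sum>u\<in>C. g y * (bpsk (u b) * lik J u y)) \<partial>iid Q)"
    by (rule Bochner_Integration.integral_sum[symmetric]) (intro bmeas_integrable bmeas_intros bmeas_lik J g)
  also have "\<dots> = (\<integral>y. real (card C) * (g y * num C J b y) \<partial>iid Q)"
    using fin by (simp add: num_def sum_distrib_left[symmetric])
  finally show ?thesis using fin by simp
qed

lemma integral_even_fun:
  assumes C: "linear_code C" and J: "finite J" and h: "bmeas h" "depends_on J h"
    and ev: "\<And>u y. u \<in> C \<Longrightarrow> h (flip u y) = h y"
  shows "(\<integral>y. h y \<partial>iid P) = (\<integral>y. h y * den C J y \<partial>iid Q)"
proof -
  have fin: "finite C" "card C > 0" "C \<noteq> {}" using C by (auto simp: linear_code_def card_gt_0_iff)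
  have "(\<integral>y. h y \<partial>iid P) = (\<integral>y. h y * lik J u y \<partial>iid Q)" if u: "u \<in> C" for u
  proof -
    have "(\<integral>y. h y \<partial>iid P) = (\<integral>y. h y * lik J (\<lambda>_. False) y \<partial>iid Q)"
      by (rule integral_iid_P[OF J h])
    also have "\<dots> = (\<integral>y. h (flip u y) * lik J (\<lambda>_. False) (flip u y) \<partial>iid Q)"
      by (rule integral_flip[symmetric]) (intro bmeas_mult h bmeas_lik J)
    also have "\<dots> = (\<integral>y. h y * lik J u y \<partial>iid Q)"
      using ev u by (simp add: lik_flip)
    finally show ?thesis .
  qed
  then have "(\<Sum>u\<in>C. \<integral>y. h y \<partial>iid P) = (\<Sum>u\<in>C. \<integral>y. h y * lik J u y \<partial>iid Q)"
    by (rule sum.cong[OF refl])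
  then have "real (card C) * (\<integral>y. h y \<partial>iid P) = (\<Sum>u\<in>C. \<integral>y. h y * lik J u y \<partial>iid Q)"
    by (simp only: sum_constant)
  also have "\<dots> = (\<integral>y. (\<Sum>u\<in>C. h y * lik J u y) \<partial>iid Q)"
    by (rule Bochner_Integration.integral_sum[symmetric]) (intro bmeas_integrable bmeas_intros bmeas_lik J h)
  also have "\<dots> = (\<integral>y. real (card C) * (h y * den C J y) \<partial>iid Q)"
    using fin by (simp add: den_def sum_distrib_left[symmetric])
  finally show ?thesis using fin by simp
qed

lemma integral_den: 
  assumes "linear_code C" "finite J"
  shows "(\<integral>y. den C J y \<partial>iid Q) = 1"
  using integral_even_fun[OF assms bmeas_const[of 1]] by (simp add: depends_on_def one.seq.prob_space)

lemma odd_fun_square_even: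
  assumes "odd_fun C b g" "odd_fun C b h" "u \<in> C"
  shows "g (flip u y) * h (flip u y) = g y * h y"
  using assms by (auto simp: odd_fun_def bpsk_def)

text \<open>The error of a conditional mean is orthogonal to functions of the observed outputs, here
  read under the zero codeword, where the bit itself is 1.\<close>

lemma integral_odd_mult_est:
  assumes C: "linear_code C" and J: "finite J" and g: "bmeas g" "depends_on J g" "odd_fun C b g"
  shows "(\<integral>y. g y * est C J b y \<partial>iid P) = (\<integral>y. g y \<partial>iid P)"
proof -
  have "finite C" using C by (simp add: linear_code_def)
  then have "(\<integral>y. g y * est C J b y \<partial>iid P) = (\<integral>y. g y * est C J b y * den C J y \<partial>iid Q)"
    by (intro integral_even_fun[OF C J])
       (auto intro!: bmeas_mult g bmeas_est J odd_fun_square_even[OF g(3) odd_fun_est[OF C]]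
             depends_on_combine[OF g(2) depends_on_est])
  then show ?thesis
    by (simp add: mult.assoc est_mult_den integral_odd_fun[OF C J g])
qed

lemma integral_est:
  assumes "linear_code C" "finite J"
  shows "(\<integral>y. est C J b y \<partial>iid P) = quality C J b"
proof -
  have "finite C" using assms by (simp add: linear_code_def)
  then show ?thesis
    using integral_odd_mult_est[OF assms bmeas_est depends_on_est[OF order_refl] odd_fun_est[OF assms(1)]] assms
    by (simp add: quality_def power2_eq_square)
qed

text \<open>The left side is one minus the mean squared error of the competitor \<open>g\<close>;
  the inequality is the mean square of \<open>est - g\<close>, expanded.\<close>

lemma quality_ge:
  assumes C: "linear_code C" and J: "finite J" and g: "bmeas g" "depends_on J g" "odd_fun C b g"
  shows "2 * (\<integral>y. g y \<partial>iid P) - (\<integral>y. (g y)\<^sup>2 \<partial>iid P) \<le> quality C J b"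
proof -
  have e: "bmeas (est C J b)" using C J by (intro bmeas_est) (auto simp: linear_code_def)
  have "0 \<le> (\<integral>y. (est C J b y - g y)\<^sup>2 \<partial>iid P)" by simp
  also have "\<dots> = (\<integral>y. (est C J b y)\<^sup>2 - 2 * (g y * est C J b y) + (g y)\<^sup>2 \<partial>iid P)"
    by (simp add: power2_diff algebra_simps)
  also have "\<dots> = quality C J b - 2 * (\<integral>y. g y * est C J b y \<partial>iid P) + (\<integral>y. (g y)\<^sup>2 \<partial>iid P)"
    by (simp add: quality_def one.bmeas_integrable bmeas_intros e g)
  finally show ?thesis by (simp add: integral_odd_mult_est[OF C J g])
qed

lemma quality_mono:
  assumes C: "linear_code C" and J: "J \<subseteq> J'" "finite J'"
  shows "quality C J b \<le> quality C J' b"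
proof -
  have "finite C" "finite J" using C J by (auto simp: linear_code_def intro: finite_subset)
  then show ?thesis
    using quality_ge[OF C J(2) bmeas_est depends_on_est[OF J(1)] odd_fun_est[OF C], of b]
      integral_est[OF C, of J b] by (simp add: quality_def)
qed

lemma quality_nonneg: "0 \<le> quality C J b"
  by (simp add: quality_def)

lemma quality_le_1:
  assumes "linear_code C" "finite J"
  shows "quality C J b \<le> 1"
proof -
  have "quality C J b \<le> (\<integral>y. 1 \<partial>iid P)"
    unfolding quality_def
  proof (rule integral_mono)
    show "integrable (iid P) (\<lambda>y. (est C J b y)\<^sup>2)"
      using assms by (intro one.bmeas_integrable) (auto intro!: bmeas_intros bmeas_est simp: linear_code_def)
  qed (auto simp: abs_est_le abs_square_le_1)
  then show ?thesis by (simp add: one.seq.prob_space)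
qed

lemma quality_two_looks:
  assumes C: "linear_code C" and J: "finite J"
    and g: "bmeas g" "depends_on J g" "odd_fun C b g"
    and h: "bmeas h" "depends_on J h" "odd_fun C b h"
    and q: "(\<integral>y. g y \<partial>iid P) = q" "(\<integral>y. (g y)\<^sup>2 \<partial>iid P) = q"
      "(\<integral>y. h y \<partial>iid P) = q" "(\<integral>y. (h y)\<^sup>2 \<partial>iid P) = q"
      "(\<integral>y. g y * h y \<partial>iid P) = c"
  shows "4 * \<alpha> * q - \<alpha>\<^sup>2 * (2 * q + 2 * c) \<le> quality C J b"
proof -
  let ?s = "\<lambda>y. \<alpha> * (g y + h y)"
  have "2 * (\<integral>y. ?s y \<partial>iid P) - (\<integral>y. (?s y)\<^sup>2 \<partial>iid P) \<le> quality C J b"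
  proof (rule quality_ge[OF C J])
    show "bmeas ?s" by (intro bmeas_intros g h)
    show "depends_on J ?s" by (rule depends_on_combine[OF g(2) h(2), of "\<lambda>a b. \<alpha> * (a + b)"])
    show "odd_fun C b ?s" using g(3) h(3) by (simp add: odd_fun_def algebra_simps)
  qed
  moreover have "(\<integral>y. ?s y \<partial>iid P) = 2 * \<alpha> * q"
    by (simp add: one.bmeas_integrable g h q)
  moreover have "(\<integral>y. (?s y)\<^sup>2 \<partial>iid P) = \<alpha>\<^sup>2 * (\<integral>y. (g y)\<^sup>2 + 2 * (g y * h y) + (h y)\<^sup>2 \<partial>iid P)"
    unfolding integral_mult_right_zero[symmetric]
    by (intro Bochner_Integration.integral_cong refl) (simp add: power2_eq_square algebra_simps)
  moreover have "(\<integral>y. (g y)\<^sup>2 + 2 * (g y * h y) + (h y)\<^sup>2 \<partial>iid P) = 2 * q + 2 * c"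
    by (simp add: one.bmeas_integrable bmeas_intros g h q)
  ultimately show ?thesis by (simp add: algebra_simps)
qed

end

context symmetric_channel
begin

section \<open>The entropy bound\<close>

lemma bmeas_mult_ln:
  assumes "bmeas h" "\<And>y. 0 \<le> h y"
  shows "bmeas (\<lambda>y. h y * ln (h y))"
proof -
  obtain B where B: "\<And>y. \<bar>h y\<bar> \<le> B" using assms(1) by (auto simp: bmeas_def)
  note [measurable] = bmeas_measurable[OF assms(1)]
  show ?thesis
  proof (rule bmeasI[of _ "1 + B\<^sup>2"])
    fix y
    have "(h y)\<^sup>2 \<le> B\<^sup>2" using B[of y] by (metis abs_ge_zero power2_abs power_mono)
    with abs_mult_ln_le[OF assms(2), of y] show "\<bar>h y * ln (h y)\<bar> \<le> 1 + B\<^sup>2" by linarith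
  qed simp
qed

lemma mult_mult_ln: "0 \<le> a \<Longrightarrow> 0 \<le> b \<Longrightarrow> a * b * ln (a * b) = a * ln a * b + a * (b * ln (b::real))"
  by (cases "a = 0"; cases "b = 0") (auto simp: ln_mult algebra_simps)

text \<open>Capacity in nats.\<close>

definition cap :: real where
  "cap = (\<integral>y. (1 + \<psi> y) * ln (1 + \<psi> y) \<partial>Q)"

lemma integral_component:
  assumes "\<eta> \<in> borel_measurable Q"
  shows "(\<integral>y. \<eta> (y k) \<partial>iid Q) = (\<integral>y. \<eta> y \<partial>Q :: real)"
proof -
  have "(\<integral>y. \<eta> y \<partial>Q) = (\<integral>y. \<eta> y \<partial>distr (iid Q) Q (\<lambda>y. y k))"
    by (subst distr_PiM_component) (auto intro: prob_space_axioms)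
  also have "\<dots> = (\<integral>y. \<eta> (y k) \<partial>iid Q)" by (rule integral_distr) (auto intro: assms)
  finally show ?thesis ..
qed

text \<open>Each likelihood factor has mean 1. The induction hands the last factor over to
  \<open>h\<close>, which is why \<open>h\<close> varies.\<close>

lemma integral_lik_mult:
  assumes "bmeas h" "depends_on {n..} h"
  shows "(\<integral>y. lik {..<n} (\<lambda>_. False) y * h y \<partial>iid Q) = (\<integral>y. h y \<partial>iid Q)"
  using assms
proof (induction n arbitrary: h)
  case (Suc n)
  have b: "bmeas (\<lambda>y. (1 + \<psi> (y n)) * h y)" by (intro bmeas_intros bmeas_psi Suc.prems)
  have d: "depends_on {n..} (\<lambda>y. (1 + \<psi> (y n)) * h y)"
    using Suc.prems(2) unfolding depends_on_def by (auto intro!: arg_cong2[of _ _ _ _ "(*)"])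
  have "(\<integral>y. lik {..<Suc n} (\<lambda>_. False) y * h y \<partial>iid Q)
      = (\<integral>y. lik {..<n} (\<lambda>_. False) y * ((1 + \<psi> (y n)) * h y) \<partial>iid Q)"
    by (simp add: lik_def mult_ac)
  also have "\<dots> = (\<integral>y. (1 + \<psi> (y n)) * h y \<partial>iid Q)" by (rule Suc.IH[OF b d])
  also have "\<dots> = (\<integral>y. h y + h y * \<psi> (y n) \<partial>iid Q)" by (simp add: algebra_simps)
  also have "\<dots> = (\<integral>y. h y \<partial>iid Q)"
    using integral_mult_psi[OF Suc.prems] by (simp add: bmeas_integrable bmeas_intros bmeas_psi Suc.prems)
  finally show ?case .
qed (simp add: lik_def)

text \<open>Relative entropy is additive over independent outputs: the logarithm of the product
  splits, and the part linear in \<open>\<psi>\<close> of the new output has mean 0.\<close>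

lemma integral_lik_ln_zero:
  "(\<integral>y. lik {..<n} (\<lambda>_. False) y * ln (lik {..<n} (\<lambda>_. False) y) \<partial>iid Q) = real n * cap"
proof (induction n)
  case (Suc n)
  define L where "L = lik {..<n} (\<lambda>_. False)"
  define e where "e y = 1 + \<psi> (y n)" for y :: "nat \<Rightarrow> 'a"
  have L: "bmeas L" "0 \<le> L y" "bmeas (\<lambda>y. L y * ln (L y))" for y
    by (auto simp: L_def intro: bmeas_lik lik_nonneg bmeas_mult_ln)
  have e1: "bmeas e" unfolding e_def by (intro bmeas_intros bmeas_psi)
  have e2: "0 \<le> e y" for y by (simp add: e_def psi_ge)
  note e = e1 e2 bmeas_mult_ln[OF e1 e2]
  have "depends_on {..<n} L" by (auto simp: L_def depends_on_def intro: lik_cong)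
  from this this have d: "depends_on {..<n} (\<lambda>y. L y * ln (L y))"
    by (rule depends_on_combine[of _ L L "\<lambda>a b. a * ln b"])
  have "(\<integral>y. lik {..<Suc n} (\<lambda>_. False) y * ln (lik {..<Suc n} (\<lambda>_. False) y) \<partial>iid Q)
      = (\<integral>y. L y * e y * ln (L y * e y) \<partial>iid Q)"
    by (simp add: L_def e_def lik_def mult_ac)
  also have "\<dots> = (\<integral>y. L y * ln (L y) + L y * ln (L y) * \<psi> (y n) + L y * (e y * ln (e y)) \<partial>iid Q)"
    by (simp add: mult_mult_ln[OF L(2) e(2)]) (simp add: e_def algebra_simps)
  also have "\<dots> = (\<integral>y. L y * ln (L y) \<partial>iid Q) + (\<integral>y. L y * ln (L y) * \<psi> (y n) \<partial>iid Q)
      + (\<integral>y. L y * (e y * ln (e y)) \<partial>iid Q)"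
    by (simp add: bmeas_integrable bmeas_add bmeas_mult[OF L(3) bmeas_psi] bmeas_mult[OF L(1) e(3)] L)
  also have "(\<integral>y. L y * ln (L y) * \<psi> (y n) \<partial>iid Q) = 0"
    by (rule integral_mult_psi[OF L(3) d]) simp
  also have "(\<integral>y. L y * (e y * ln (e y)) \<partial>iid Q) = (\<integral>y. e y * ln (e y) \<partial>iid Q)"
    unfolding L_def by (rule integral_lik_mult[OF e(3)]) (auto simp: depends_on_def e_def)
  also have "\<dots> = cap"
    unfolding e_def cap_def by (rule integral_component[of "\<lambda>y. (1 + \<psi> y) * ln (1 + \<psi> y)"]) simp
  also have "(\<integral>y. L y * ln (L y) \<partial>iid Q) = real n * cap"
    using Suc.IH by (simp add: L_def)
  finally show ?case by (simp add: algebra_simps)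
qed (simp add: lik_def)

lemma integral_lik_ln:
  "(\<integral>y. lik {..<n} v y * ln (lik {..<n} v y) \<partial>iid Q) = real n * cap"
  by (subst integral_lik_ln_zero[symmetric], subst (2) integral_flip[where v=v, symmetric])
     (auto simp: lik_flip intro!: bmeas_mult_ln bmeas_lik lik_nonneg)

text \<open>The density of an output is affine in its input, so only the conditional mean of that
  input enters the conditional density of the next output.\<close>

lemma den_Suc: "den C {..<Suc n} y = den C {..<n} y * (1 + \<psi> (y n) * est C {..<n} n y)"
proof -
  have "den C {..<Suc n} y = den C {..<n} y + \<psi> (y n) * num C {..<n} n y"
    by (simp add: den_def num_def lik_def algebra_simps sum.distrib sum_distrib_left add_divide_distrib)
  then show ?thesis by (simp add: est_mult_den[symmetric] algebra_simps)
qed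

definition den_entropy :: "(nat \<Rightarrow> bool) set \<Rightarrow> nat \<Rightarrow> real" where
  "den_entropy C n = (\<integral>y. den C {..<n} y * ln (den C {..<n} y) \<partial>iid Q)"

text \<open>Chain rule for the relative entropy between the law of the received word and the
  product law \<open>iid Q\<close>: one more output adds the information it carries about the
  earlier ones, which is at most the quality of the estimate of its input.\<close>

lemma den_entropy_Suc:
  assumes C: "linear_code C"
  shows "den_entropy C (Suc n) \<le> den_entropy C n + quality C {..<n} n"
proof -
  define D where "D = den C {..<n}"
  define f where "f = est C {..<n} n"
  \<comment> \<open>The coefficient of \<open>\<psi> (y n)\<close> in the pointwise bound below; it
    depends on earlier outputs only, so its term has mean 0.\<close>
  define H where "H y = f y * (D y * ln (D y)) + f y * D y" for y
  have fin: "finite C" using C by (simp add: linear_code_def)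
  have D: "bmeas D" "0 \<le> D y" "bmeas (\<lambda>y. D y * ln (D y))" for y
    using fin by (auto simp: D_def intro: bmeas_den den_nonneg bmeas_mult_ln)
  have f: "bmeas f" "\<bar>f y\<bar> \<le> 1" for y
    using fin by (auto simp: f_def intro: bmeas_est abs_est_le)
  have H: "bmeas H" unfolding H_def by (intro bmeas_add bmeas_mult[OF f(1)] D)
  have df: "depends_on {..<n} f" unfolding f_def by (rule depends_on_est) simp
  have "depends_on {..<n} D" by (auto simp: D_def depends_on_def intro: den_cong)
  then have dH: "depends_on {..<n} H"
    unfolding H_def using df by (rule depends_on_combine[of _ D f "\<lambda>a b. b * (a * ln a) + b * a"])
  have pt: "den C {..<Suc n} y * ln (den C {..<Suc n} y) \<le> D y * ln (D y) + (f y)\<^sup>2 * D y + H y * \<psi> (y n)" for y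
  proof -
    define s where "s = \<psi> (y n) * f y"
    have "\<bar>s\<bar> \<le> 1 * 1" unfolding s_def abs_mult by (intro mult_mono psi_bound f) auto
    then have s: "-1 \<le> s" "0 \<le> 1 + s" by (auto simp: abs_le_iff)
    \<comment> \<open>The reliability of the new output itself is bounded by 1, which leaves only
      the estimate of its input.\<close>
    have "s\<^sup>2 = (\<psi> (y n))\<^sup>2 * (f y)\<^sup>2" by (simp add: s_def power_mult_distrib)
    also have "\<dots> \<le> 1 * (f y)\<^sup>2"
      using psi_bound[of "y n"] by (intro mult_right_mono) (auto simp: abs_square_le_1)
    finally have s2: "s\<^sup>2 \<le> (f y)\<^sup>2" by simp
    have "den C {..<Suc n} y * ln (den C {..<Suc n} y) = D y * (1 + s) * ln (D y * (1 + s))"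
      by (simp add: den_Suc D_def f_def s_def)
    also have "\<dots> = D y * ln (D y) * (1 + s) + D y * ((1 + s) * ln (1 + s))"
      by (rule mult_mult_ln[OF D(2) s(2)])
    also have "\<dots> \<le> D y * ln (D y) * (1 + s) + D y * (s + (f y)\<^sup>2)"
      using mult_ln_one_plus_le[OF s(1)] s2 by (intro add_left_mono mult_left_mono D) auto
    also have "\<dots> = D y * ln (D y) + (f y)\<^sup>2 * D y + H y * \<psi> (y n)"
      by (simp add: H_def s_def algebra_simps)
    finally show ?thesis .
  qed
  have "den_entropy C (Suc n) \<le> (\<integral>y. D y * ln (D y) + (f y)\<^sup>2 * D y + H y * \<psi> (y n) \<partial>iid Q)"
    unfolding den_entropy_def
    by (intro integral_mono pt bmeas_integrable bmeas_add D bmeas_mult[OF bmeas_power2[OF f(1)] D(1)]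
          bmeas_mult[OF H bmeas_psi] bmeas_mult_ln bmeas_den den_nonneg fin) auto
  also have "\<dots> = (\<integral>y. D y * ln (D y) \<partial>iid Q) + (\<integral>y. (f y)\<^sup>2 * D y \<partial>iid Q) + (\<integral>y. H y * \<psi> (y n) \<partial>iid Q)"
    by (simp add: bmeas_integrable bmeas_add D bmeas_mult[OF bmeas_power2[OF f(1)] D(1)] bmeas_mult[OF H bmeas_psi])
  also have "(\<integral>y. H y * \<psi> (y n) \<partial>iid Q) = 0"
    by (rule integral_mult_psi[OF H dH]) simp
  also have "(\<integral>y. (f y)\<^sup>2 * D y \<partial>iid Q) = quality C {..<n} n"
  proof -
    have "(f (flip u y))\<^sup>2 = (f y)\<^sup>2" if "u \<in> C" for u y
      using odd_fun_square_even[OF odd_fun_est[OF C, of n "{..<n}"] odd_fun_est[OF C, of n "{..<n}"] that, of y]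
      by (simp add: f_def power2_eq_square)
    then show ?thesis
      unfolding quality_def f_def[symmetric] D_def
      by (intro integral_even_fun[OF C, symmetric] bmeas_power2 f)
         (auto intro: depends_on_combine[OF df df, of "\<lambda>a b. a\<^sup>2"])
  qed
  finally show ?thesis by (simp add: den_entropy_def D_def)
qed

lemma den_entropy_le:
  assumes C: "linear_code C"
  shows "den_entropy C N \<le> (\<Sum>n<N. quality C {..<n} n)"
proof (induction N)
  case 0
  have "den C {..<0} y = 1" for y
    using C by (auto simp: den_def lik_def linear_code_def)
  then show ?case by (simp add: den_entropy_def)
next
  case (Suc N)
  with den_entropy_Suc[OF C, of N] show ?case by simp
qed

text \<open>The mutual information between codeword and output is at most the entropy of the
  codeword, because \<open>lik v \<le> card C * den\<close>.\<close>

lemma den_entropy_ge: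
  assumes C: "linear_code C"
  shows "real N * cap - ln (real (card C)) \<le> den_entropy C N"
proof -
  have fin: "finite C" "card C > 0" "C \<noteq> {}" using C by (auto simp: linear_code_def card_gt_0_iff)
  define D where "D = den C {..<N}"
  define L where "L = lik {..<N}"
  have D: "bmeas D" "0 \<le> D y" "bmeas (\<lambda>y. D y * ln (D y))" for y
    using fin by (auto simp: D_def intro: bmeas_den den_nonneg bmeas_mult_ln)
  have L: "bmeas (L v)" "0 \<le> L v y" "bmeas (\<lambda>y. L v y * ln (L v y))" for v y
    by (auto simp: L_def intro: bmeas_lik lik_nonneg bmeas_mult_ln)
  have DL: "(\<Sum>v\<in>C. L v y) = real (card C) * D y" for y
    using fin by (simp add: D_def L_def den_def)
  have pt: "(\<Sum>v\<in>C. L v y * ln (L v y)) \<le> real (card C) * (ln (real (card C)) * D y + D y * ln (D y))" for y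
  \<comment> \<open>The logarithm comparison needs a positive mixture; where the mixture vanishes,
    so does every likelihood in it.\<close>
  proof (cases "D y = 0")
    case True
    then have "L v y = 0" if "v \<in> C" for v
      using DL[of y] sum_nonneg_eq_0_iff[OF fin(1), of "\<lambda>v. L v y"] L(2) that by auto
    with True show ?thesis by simp
  next
    case False
    with D(2)[of y] have Dp: "D y > 0" by simp
    have "(\<Sum>v\<in>C. L v y * ln (L v y)) \<le> (\<Sum>v\<in>C. L v y * (ln (real (card C)) + ln (D y)))"
    proof (intro sum_mono)
      fix v assume v: "v \<in> C"
      show "L v y * ln (L v y) \<le> L v y * (ln (real (card C)) + ln (D y))"
      proof (cases "L v y = 0")
        case False
        with L(2)[of v y] have Lp: "L v y > 0" by simp
        have "L v y \<le> real (card C) * D y"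
          unfolding DL[symmetric] using v fin L(2) by (intro member_le_sum) auto
        then have "ln (L v y) \<le> ln (real (card C) * D y)"
          using Lp Dp fin by (subst ln_le_cancel_iff) auto
        then show ?thesis using Lp Dp fin by (intro mult_left_mono) (auto simp: ln_mult)
      qed simp
    qed
    also have "\<dots> = real (card C) * (ln (real (card C)) * D y + D y * ln (D y))"
      unfolding sum_distrib_right[symmetric] DL by (simp add: algebra_simps)
    finally show ?thesis .
  qed
  have "real (card C) * (real N * cap) = (\<Sum>v\<in>C. \<integral>y. L v y * ln (L v y) \<partial>iid Q)"
    by (simp add: L_def integral_lik_ln)
  also have "\<dots> = (\<integral>y. (\<Sum>v\<in>C. L v y * ln (L v y)) \<partial>iid Q)"
    by (rule Bochner_Integration.integral_sum[symmetric]) (intro bmeas_integrable L)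
  also have "\<dots> \<le> (\<integral>y. real (card C) * (ln (real (card C)) * D y + D y * ln (D y)) \<partial>iid Q)"
    by (intro integral_mono pt bmeas_integrable bmeas_sum bmeas_mult[OF bmeas_const] bmeas_add L D fin)
  also have "\<dots> = real (card C) * (ln (real (card C)) + den_entropy C N)"
    using integral_den[OF C, of "{..<N}"]
    by (simp add: bmeas_integrable bmeas_mult[OF bmeas_const] D) (simp add: D_def den_entropy_def)
  finally show ?thesis using fin by simp
qed

text \<open>The chain rule uses only earlier outputs; observing all other positions can only raise
  each quality.\<close>

lemma quality_entropy_bound:
  assumes "linear_code C" and "\<And>n. n < N \<Longrightarrow> quality C ({..<N} - {n}) n \<le> q"
  shows "real N * cap - ln (real (card C)) \<le> real N * q"
proof -
  have "(\<Sum>n<N. quality C {..<n} n) \<le> (\<Sum>n<N. q)"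
    by (intro sum_mono order_trans[OF quality_mono[OF assms(1)] assms(2)]) auto
  with den_entropy_ge[OF assms(1), of N] den_entropy_le[OF assms(1), of N] show ?thesis by simp
qed

end

section \<open>Reed--Muller codes\<close>

lemma odd_card_insert:
  assumes "finite A" "x \<notin> A"
  shows "odd (card {y \<in> insert x A. P y}) \<longleftrightarrow> P x \<noteq> odd (card {y \<in> A. P y})"
proof -
  have "{y \<in> insert x A. P y} = (if P x then insert x {y \<in> A. P y} else {y \<in> A. P y})" by auto
  then show ?thesis using assms by auto
qed

lemma odd_card_neq:
  assumes "finite A"
  shows "odd (card {x \<in> A. P x \<noteq> R x}) \<longleftrightarrow> odd (card {x \<in> A. P x}) \<noteq> odd (card {x \<in> A. R x})"
  using assms
proof (induction rule: finite_induct)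
  case (insert x A)
  show ?case unfolding odd_card_insert[OF insert.hyps] using insert.IH by blast
qed simp

text \<open>Degree as a property of Boolean functions with the coefficients hidden, so that sums,
  products and substitutions are closure rules.\<close>

definition deg_le :: "nat \<Rightarrow> nat \<Rightarrow> ((nat \<Rightarrow> bool) \<Rightarrow> bool) \<Rightarrow> bool" where
  "deg_le r m p \<longleftrightarrow> (\<exists>c. p = mpoly_eval r m c)"

lemma finite_monomials: "finite (monomials r m)"
  unfolding monomials_def by (rule finite_subset[of _ "Pow {..<m}"]) auto

lemma deg_le_neq:
  assumes "deg_le r m p" "deg_le r m q"
  shows "deg_le r m (\<lambda>v. p v \<noteq> q v)"
proof -
  obtain c c' where c: "p = mpoly_eval r m c" "q = mpoly_eval r m c'"
    using assms by (auto simp: deg_le_def)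
  have "(p v \<noteq> q v) = mpoly_eval r m (\<lambda>S. c S \<noteq> c' S) v" for v
    unfolding c mpoly_eval_def odd_card_neq[OF finite_monomials, symmetric]
    by (intro arg_cong[where f="\<lambda>x. odd (card x)"]) auto
  then show ?thesis unfolding deg_le_def by blast
qed

lemma deg_le_False: "deg_le r m (\<lambda>_. False)"
  unfolding deg_le_def by (rule exI[of _ "\<lambda>_. False"]) (simp add: mpoly_eval_def fun_eq_iff)

lemma deg_le_monomial:
  assumes "S \<subseteq> {..<m}" "card S \<le> r"
  shows "deg_le r m (\<lambda>v. \<forall>j\<in>S. v j)"
proof -
  have "{T \<in> monomials r m. T = S \<and> (\<forall>j\<in>T. v j)} = (if \<forall>j\<in>S. v j then {S} else {})" for v
    using assms by (auto simp: monomials_def)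
  then have "(\<lambda>v. \<forall>j\<in>S. v j) = mpoly_eval r m (\<lambda>T. T = S)"
    by (auto simp: mpoly_eval_def fun_eq_iff)
  then show ?thesis unfolding deg_le_def by blast
qed

lemma deg_le_True: "deg_le r m (\<lambda>_. True)"
  using deg_le_monomial[of "{}" m r] by simp

lemma deg_le_parity:
  assumes "finite A" "\<And>x. x \<in> A \<Longrightarrow> deg_le r m (p x)"
  shows "deg_le r m (\<lambda>v. odd (card {x \<in> A. p x v}))"
  using assms
proof (induction rule: finite_induct)
  case (insert x A)
  then show ?case unfolding odd_card_insert[OF insert.hyps] by (intro deg_le_neq) auto
qed (simp add: deg_le_False)

text \<open>A product of parities is the parity over pairs of monomials, and a pair merges into the
  monomial on the union since variables are idempotent.\<close>

lemma deg_le_conj: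
  assumes "deg_le r m p" "deg_le s m q"
  shows "deg_le (r + s) m (\<lambda>v. p v \<and> q v)"
proof -
  obtain c c' where c: "p = mpoly_eval r m c" "q = mpoly_eval s m c'"
    using assms by (auto simp: deg_le_def)
  have "deg_le (r + s) m (\<lambda>v. odd (card {x \<in> monomials r m \<times> monomials s m.
      (c (fst x) \<and> c' (snd x)) \<and> (\<forall>j\<in>fst x \<union> snd x. v j)}))"
  proof (rule deg_le_parity)
    fix x assume x: "x \<in> monomials r m \<times> monomials s m"
    have "deg_le (r + s) m (\<lambda>v. \<forall>j\<in>fst x \<union> snd x. v j)"
      using x card_Un_le[of "fst x" "snd x"]
      by (intro deg_le_monomial) (auto simp: monomials_def)
    then show "deg_le (r + s) m (\<lambda>v. (c (fst x) \<and> c' (snd x)) \<and> (\<forall>j\<in>fst x \<union> snd x. v j))"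
      by (cases "c (fst x) \<and> c' (snd x)") (auto simp: deg_le_False)
  qed (simp add: finite_monomials)
  also have "(\<lambda>v. odd (card {x \<in> monomials r m \<times> monomials s m.
      (c (fst x) \<and> c' (snd x)) \<and> (\<forall>j\<in>fst x \<union> snd x. v j)})) = (\<lambda>v. p v \<and> q v)"
  proof
    fix v
    have "{x \<in> monomials r m \<times> monomials s m. (c (fst x) \<and> c' (snd x)) \<and> (\<forall>j\<in>fst x \<union> snd x. v j)}
        = {S \<in> monomials r m. c S \<and> (\<forall>j\<in>S. v j)} \<times> {S \<in> monomials s m. c' S \<and> (\<forall>j\<in>S. v j)}"
      by auto
    then show "odd (card {x \<in> monomials r m \<times> monomials s m.
        (c (fst x) \<and> c' (snd x)) \<and> (\<forall>j\<in>fst x \<union> snd x. v j)}) = (p v \<and> q v)"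
      by (simp add: c mpoly_eval_def card_cartesian_product)
  qed
  finally show ?thesis .
qed

lemma deg_le_mono:
  assumes "deg_le r m p" "r \<le> s"
  shows "deg_le s m p"
  using deg_le_conj[OF assms(1) deg_le_True[of "s - r"]] assms(2) by simp

lemma deg_le_product:
  assumes "finite S" "\<And>j. j \<in> S \<Longrightarrow> deg_le 1 m (l j)"
  shows "deg_le (card S) m (\<lambda>v. \<forall>j\<in>S. l j v)"
  using assms
proof (induction rule: finite_induct)
  case (insert j S)
  then show ?case using deg_le_conj[of 1 m "l j" "card S" "\<lambda>v. \<forall>j\<in>S. l j v"] by simp
qed (simp add: deg_le_True)

text \<open>Each monomial becomes a product of at most \<open>r\<close> affine functions.\<close>

lemma deg_le_substitute:
  assumes "deg_le r m p" "\<And>j. j < m \<Longrightarrow> deg_le 1 n (l j)"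
  shows "deg_le r n (\<lambda>v. p (\<lambda>j. l j v))"
proof -
  obtain c where c: "p = mpoly_eval r m c" using assms(1) by (auto simp: deg_le_def)
  have "deg_le r n (\<lambda>v. odd (card {S \<in> monomials r m. c S \<and> (\<forall>j\<in>S. l j v)}))"
  proof (rule deg_le_parity[OF finite_monomials])
    fix S assume S: "S \<in> monomials r m"
    then have "finite S" by (auto simp: monomials_def intro: finite_subset)
    with S have "deg_le r n (\<lambda>v. \<forall>j\<in>S. l j v)"
      by (intro deg_le_mono[OF deg_le_product] assms(2)) (auto simp: monomials_def)
    then show "deg_le r n (\<lambda>v. c S \<and> (\<forall>j\<in>S. l j v))"
      by (cases "c S") (auto simp: deg_le_False)
  qed
  then show ?thesis by (simp add: c mpoly_eval_def)
qed

lemma deg_le_cong: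
  assumes "deg_le r m p" "\<And>j. j < m \<Longrightarrow> v j = v' j"
  shows "p v = p v'"
proof -
  obtain c where c: "p = mpoly_eval r m c" using assms(1) by (auto simp: deg_le_def)
  have "{S \<in> monomials r m. c S \<and> (\<forall>j\<in>S. v j)} = {S \<in> monomials r m. c S \<and> (\<forall>j\<in>S. v' j)}"
    using assms(2) by (auto simp: monomials_def)
  then show ?thesis by (simp add: c mpoly_eval_def)
qed

lemma tau_inv_eq_bit: "tau_inv k = bit k"
  by (simp add: tau_inv_def bit_iff_odd fun_eq_iff)

lemma RM_eq: "RM r m = {u. \<exists>p. deg_le r m p \<and> u = (\<lambda>k. if k < 2 ^ m then p (bit k) else False)}"
  unfolding RM_def deg_le_def tau_inv_eq_bit by auto

text \<open>Pullback of a codeword along an index map whose bits are affine; translations and shears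
  are the two instances.\<close>

lemma RM_substitute:
  assumes "u \<in> RM r m" and "\<And>k. k < 2 ^ n \<Longrightarrow> \<rho> k < 2 ^ m"
    and "\<And>j. j < m \<Longrightarrow> deg_le 1 n (l j)"
    and "\<And>j k. j < m \<Longrightarrow> k < 2 ^ n \<Longrightarrow> bit (\<rho> k) j = l j (bit k)"
  shows "(\<lambda>k. if k < 2 ^ n then u (\<rho> k) else False) \<in> RM r n"
proof -
  obtain p where p: "deg_le r m p" "u = (\<lambda>k. if k < 2 ^ m then p (bit k) else False)"
    using assms(1) by (auto simp: RM_eq)
  have "p (bit (\<rho> k)) = p (\<lambda>j. l j (bit k))" if "k < 2 ^ n" for k
    by (rule deg_le_cong[OF p(1)]) (simp add: assms(4) that)
  then have "(\<lambda>k. if k < 2 ^ n then u (\<rho> k) else False)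
      = (\<lambda>k. if k < 2 ^ n then p (\<lambda>j. l j (bit k)) else False)"
    using assms(2) by (auto simp: p(2) fun_eq_iff)
  moreover have "deg_le r n (\<lambda>v. p (\<lambda>j. l j v))"
    by (rule deg_le_substitute[OF p(1) assms(3)])
  ultimately show ?thesis unfolding RM_eq by blast
qed

lemma card_monomials: "card (monomials r m) = (\<Sum>i\<le>r. m choose i)"
proof -
  have "monomials r m = (\<Union>i\<in>{..r}. {S. S \<subseteq> {..<m} \<and> card S = i})"
    by (auto simp: monomials_def)
  then have "card (monomials r m) = (\<Sum>i\<le>r. card {S. S \<subseteq> {..<m} \<and> card S = i})"
    by (simp, subst card_UN_disjoint) (auto intro: finite_subset[of _ "Pow {..<m}"])
  then show ?thesis by (simp add: n_subsets)
qed

lemma RM_subset_image: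
  "RM r m \<subseteq> (\<lambda>A k. if k < 2 ^ m then mpoly_eval r m (\<lambda>S. S \<in> A) (tau_inv k) else False) ` Pow (monomials r m)"
proof
  fix u assume "u \<in> RM r m"
  then obtain c where c: "u = (\<lambda>k. if k < 2 ^ m then mpoly_eval r m c (tau_inv k) else False)"
    by (auto simp: RM_def)
  have "mpoly_eval r m c v = mpoly_eval r m (\<lambda>S. S \<in> {S \<in> monomials r m. c S}) v" for v
    unfolding mpoly_eval_def by (intro arg_cong[where f="\<lambda>x. odd (card x)"]) auto
  then show "u \<in> (\<lambda>A k. if k < 2 ^ m then mpoly_eval r m (\<lambda>S. S \<in> A) (tau_inv k) else False) ` Pow (monomials r m)"
    unfolding c by (intro image_eqI[of _ _ "{S \<in> monomials r m. c S}"]) auto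
qed

lemma finite_RM: "finite (RM r m)"
  by (rule finite_subset[OF RM_subset_image]) (simp add: finite_monomials)

lemma card_RM_le: "card (RM r m) \<le> 2 ^ (\<Sum>i\<le>r. m choose i)"
proof -
  have "card (RM r m) \<le> card (Pow (monomials r m))"
    by (rule order_trans[OF card_mono[OF _ RM_subset_image] card_image_le]) (auto simp: finite_monomials)
  then show ?thesis by (simp add: card_Pow finite_monomials card_monomials)
qed

lemma linear_code_RM: "linear_code (RM r m)"
  unfolding linear_code_def
proof (intro conjI ballI finite_RM)
  show "RM r m \<noteq> {}" by (auto simp: RM_def)
  fix u v assume "u \<in> RM r m" "v \<in> RM r m"
  then obtain p q where "deg_le r m p" "u = (\<lambda>k. if k < 2 ^ m then p (bit k) else False)"
    "deg_le r m q" "v = (\<lambda>k. if k < 2 ^ m then q (bit k) else False)"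
    by (auto simp: RM_eq)
  moreover from this have "deg_le r m (\<lambda>v. p v \<noteq> q v)" by (intro deg_le_neq)
  ultimately show "(\<lambda>k. u k \<noteq> v k) \<in> RM r m"
    unfolding RM_eq by (intro CollectI exI[of _ "\<lambda>v. p v \<noteq> q v"]) auto
qed

section \<open>Translations and hyperplane restrictions of Reed--Muller codes\<close>

lemma deg_le_var: "j < m \<Longrightarrow> deg_le 1 m (\<lambda>v. v j)"
  using deg_le_monomial[of "{j}" m 1] by simp

lemma xor_less_exp: "(a::nat) < 2 ^ m \<Longrightarrow> b < 2 ^ m \<Longrightarrow> xor a b < 2 ^ m"
  using take_bit_xor[of m a b] by (simp add: take_bit_nat_eq_self_iff[symmetric])

lemma RM_translate:
  assumes "u \<in> RM r m" "b < 2 ^ m"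
  shows "(\<lambda>k. if k < 2 ^ m then u (xor b k) else False) \<in> RM r m"
proof (rule RM_substitute[OF assms(1)])
  fix j assume "j < m"
  moreover have "deg_le 1 m (\<lambda>_. bit b j)"
    using deg_le_True deg_le_False by (cases "bit b j") auto
  ultimately show "deg_le 1 m (\<lambda>v. bit b j \<noteq> v j)"
    by (intro deg_le_neq deg_le_var)
qed (auto simp: xor_less_exp assms bit_xor_iff)

text \<open>The linear map adding the functional \<open>a\<close> to bit \<open>d\<close>. On
  \<open>{..<2 ^ d}\<close> it parametrizes the graph of \<open>a\<close>; for
  \<open>a \<subseteq> {..<d}\<close> it is an involution of all naturals and hence permutes the
  whole output sequence.\<close>

definition shear :: "nat \<Rightarrow> nat set \<Rightarrow> nat \<Rightarrow> nat" where
  "shear d a k = (if odd (card {j \<in> a. bit k j}) then xor k (2 ^ d) else k)"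

lemma bit_shear: "bit (shear d a k) j = (if j = d then bit k d \<noteq> odd (card {j \<in> a. bit k j}) else bit k j)"
  by (auto simp: shear_def bit_xor_iff bit_exp_iff)

lemma shear_shear:
  assumes "a \<subseteq> {..<d}"
  shows "shear d a (shear d a k) = k"
proof -
  have "{j \<in> a. bit (shear d a k) j} = {j \<in> a. bit k j}"
    using assms by (auto simp: bit_shear)
  then have "bit (shear d a (shear d a k)) n = bit k n" for n
    by (subst bit_shear) (auto simp: bit_shear)
  then show ?thesis by (intro bit_eqI)
qed

lemma inj_shear: "a \<subseteq> {..<d} \<Longrightarrow> inj (shear d a)"
  by (rule inj_on_inverseI[of _ "shear d a"]) (simp add: shear_shear)

lemma shear_0 [simp]: "shear d a 0 = 0"
  by (simp add: shear_def)

lemma shear_eq_0_iff: "a \<subseteq> {..<d} \<Longrightarrow> shear d a k = 0 \<longleftrightarrow> k = 0"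
  by (metis shear_0 shear_shear)

lemma shear_less:
  assumes "k < 2 ^ d"
  shows "shear d a k < 2 ^ Suc d"
proof -
  have "k < 2 ^ Suc d" "(2::nat) ^ d < 2 ^ Suc d" using assms by auto
  then show ?thesis by (auto simp: shear_def simp del: power_Suc intro: xor_less_exp)
qed

lemma RM_shear:
  assumes "u \<in> RM r (Suc d)" "a \<subseteq> {..<d}"
  shows "(\<lambda>k. if k < 2 ^ d then u (shear d a k) else False) \<in> RM r d"
proof (rule RM_substitute[OF assms(1) shear_less])
  fix j assume j: "j < Suc d"
  show "deg_le 1 d (if j = d then (\<lambda>v. odd (card {j \<in> a. v j})) else (\<lambda>v. v j))"
    using j assms(2) finite_subset[OF assms(2)]
    by (cases "j = d") (auto intro!: deg_le_parity deg_le_var simp del: One_nat_def)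
  fix k :: nat assume "k < 2 ^ d"
  then have "\<not> bit k d" by (simp add: bit_iff_odd)
  then show "bit (shear d a k) j = (if j = d then (\<lambda>v. odd (card {j \<in> a. v j})) else (\<lambda>v. v j)) (bit k)"
    by (auto simp: bit_shear)
qed

text \<open>Toggling \<open>j\<close> in \<open>a\<close> exchanges even and odd counts.\<close>

lemma card_even_subsets:
  assumes "finite X" "j \<in> X" "P j"
  shows "2 * card {a \<in> Pow X. even (card {i \<in> a. P i})} = 2 ^ card X"
proof -
  let ?E = "{a \<in> Pow X. even (card {i \<in> a. P i})}" and ?O = "{a \<in> Pow X. odd (card {i \<in> a. P i})}"
  let ?t = "\<lambda>a. if j \<in> a then a - {j} else insert j a"
  have t: "odd (card {i \<in> ?t a. P i}) \<longleftrightarrow> even (card {i \<in> a. P i})" if "a \<subseteq> X" for a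
  proof (cases "j \<in> a")
    case True
    with that assms show ?thesis
      using odd_card_insert[of "a - {j}" j P] finite_subset[OF that] by (auto simp: insert_absorb)
  next
    case False
    with that assms show ?thesis
      using odd_card_insert[of a j P] finite_subset[OF that] by auto
  qed
  have "bij_betw ?t ?E ?O"
  proof (rule bij_betw_byWitness[where f'="?t"])
    have "?t a \<subseteq> X" if "a \<subseteq> X" for a using that assms(2) by auto
    with t show "?t ` ?E \<subseteq> ?O" "?t ` ?O \<subseteq> ?E" by blast+
  qed auto
  then have "card ?E = card ?O" by (rule bij_betw_same_card)
  moreover have "card ?E + card ?O = card (Pow X)"
    using assms(1) by (subst card_Un_disjoint[symmetric]) (auto intro!: arg_cong[where f=card])
  ultimately show ?thesis using assms(1) by (simp add: card_Pow)
qed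

context symmetric_channel
begin

section \<open>The two-look recursion\<close>

text \<open>Position 0 lies on every hyperplane used below, so its output would be shared by all
  pairs of looks and break the count of one half.\<close>

definition RM_quality :: "nat \<Rightarrow> nat \<Rightarrow> real" where
  "RM_quality r m = quality (RM r m) ({..<2 ^ m} - {0}) 0"

text \<open>Translation by \<open>b\<close> is an automorphism of the code that moves position
  \<open>b\<close> to 0 and merely permutes the iid outputs.\<close>

lemma quality_RM_translate:
  assumes b: "b < 2 ^ m"
  shows "quality (RM r m) ({..<2 ^ m} - {b}) b = RM_quality r m"
proof -
  let ?C = "RM r m" and ?J = "{..<2 ^ m} - {b}" and ?K = "{..<2 ^ m} - {0::nat}"
  define T where "T v = (\<lambda>k. if k < 2 ^ m then v (xor b k) else False)" for v :: "nat \<Rightarrow> bool"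
  have TC: "T v \<in> ?C" if "v \<in> ?C" for v
    unfolding T_def by (rule RM_translate[OF that b])
  have xx: "xor b (xor b k) = k" for k :: nat
    by (simp add: xor.assoc[symmetric])
  have x0: "xor b k = 0 \<longleftrightarrow> k = b" for k
    by (metis xx xor.right_neutral xor_self_eq)
  have xb: "xor b k = b \<longleftrightarrow> k = 0" for k
    by (metis xx xor.right_neutral xor_self_eq)
  have out: "v k = False" if "v \<in> ?C" "\<not> k < 2 ^ m" for v k
    using that by (auto simp: RM_def)
  have TT: "T (T v) = v" if "v \<in> ?C" for v
  proof
    fix k show "T (T v) k = v k"
      using out[OF that, of k] xor_less_exp[OF b, of k] by (simp add: T_def xx)
  qed
  have lik: "lik ?J v y = lik ?K (T v) (\<lambda>k. y (xor b k))" for v y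
    unfolding lik_def
  proof (rule prod.reindex_bij_witness[of _ "xor b" "xor b"])
    fix k assume k: "k \<in> ?J"
    then show "xor b k \<in> ?K" using xor_less_exp[OF b, of k] x0[of k] by simp
    show "1 + bpsk (T v (xor b k)) * \<psi> (y (xor b (xor b k))) = 1 + bpsk (v k) * \<psi> (y k)"
      using k xor_less_exp[OF b, of k] by (simp add: T_def xx)
  next
    fix k assume "k \<in> ?K"
    then show "xor b k \<in> ?J" using xor_less_exp[OF b, of k] xb[of k] by simp
  qed (simp_all add: xx)
  have bij: "(\<Sum>v\<in>?C. F (T v)) = (\<Sum>v\<in>?C. F v)" for F :: "_ \<Rightarrow> real"
    by (rule sum.reindex_bij_witness[of _ T T]) (auto simp: TT TC)
  have "v b = T v 0" for v using b by (simp add: T_def)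
  then have "num ?C ?J b y = num ?C ?K 0 (\<lambda>k. y (xor b k))" for y
    using bij[of "\<lambda>v. bpsk (v 0) * lik ?K v (\<lambda>k. y (xor b k))"] by (simp add: num_def lik)
  moreover have "den ?C ?J y = den ?C ?K (\<lambda>k. y (xor b k))" for y
    using bij[of "\<lambda>v. lik ?K v (\<lambda>k. y (xor b k))"] by (simp add: den_def lik)
  ultimately have "est ?C ?J b y = est ?C ?K 0 (\<lambda>k. y (xor b k))" for y
    by (simp add: est_def)
  moreover have "inj (xor b)" by (rule inj_on_inverseI[of _ "xor b"]) (simp add: xx)
  ultimately show ?thesis
    unfolding RM_quality_def quality_def
    using one.integral_reindex[of "\<lambda>y. (est ?C ?K 0 y)\<^sup>2" "xor b"]
    by (simp add: bmeas_power2 bmeas_est finite_RM)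
qed

lemma RM_quality_range: "0 \<le> RM_quality r m" "RM_quality r m \<le> 1"
  unfolding RM_quality_def by (auto intro: quality_nonneg quality_le_1 linear_code_RM)

text \<open>By translation one number bounds the quality at all positions in the entropy bound; the
  count of monomials bounds the codeword entropy by the rate.\<close>

lemma RM_quality_ge_rate_gap: "cap - ln 2 * RM_rate r m \<le> RM_quality r m"
proof -
  have "real (2 ^ m) * cap - ln (real (card (RM r m))) \<le> real (2 ^ m) * RM_quality r m"
    by (rule quality_entropy_bound[OF linear_code_RM]) (simp add: quality_RM_translate)
  moreover have "ln (real (card (RM r m))) \<le> ln (2 ^ (\<Sum>i\<le>r. m choose i))"
  proof (subst ln_le_cancel_iff)
    show "0 < real (card (RM r m))"
      using linear_code_RM[of r m] by (auto simp: linear_code_def card_gt_0_iff)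
    have "real (card (RM r m)) \<le> real (2 ^ (\<Sum>i\<le>r. m choose i))"
      using card_RM_le by (intro of_nat_mono)
    then show "real (card (RM r m)) \<le> 2 ^ (\<Sum>i\<le>r. m choose i)" by simp
  qed auto
  moreover have "ln (2 ^ (\<Sum>i\<le>r. m choose i)) = 2 ^ m * (ln 2 * RM_rate r m)"
    by (simp add: ln_realpow RM_rate_def)
  ultimately have "2 ^ m * (cap - ln 2 * RM_rate r m) \<le> 2 ^ m * RM_quality r m"
    by (simp add: algebra_simps)
  then show ?thesis by simp
qed

text \<open>The sheared copy of the subcube \<open>{..<2^d}\<close> that belongs to \<open>a\<close> meets the subcube in the kernel
  of the linear functional \<open>a\<close>; given the outputs there, the two looks are independent copies of
  each other.\<close>

lemma integral_est_shear:
  fixes d :: nat and a :: "nat set"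
  defines "J \<equiv> {..<2 ^ d} - {0::nat}"
  assumes f: "bmeas f" "depends_on J f"
  shows "(\<integral>y. f y * f (\<lambda>k. y (shear d a k)) \<partial>iid P)
    = one.energy f {k \<in> J. even (card {j \<in> a. bit k j})}"
proof -
  let ?S = "{k \<in> J. even (card {j \<in> a. bit k j})}" and ?N = "{..<2 ^ d :: nat}"
  let ?H = "\<lambda>y. f y * f (\<lambda>k. y (shear d a k))"
  have H: "one.bmeas ?H"
    using bmeas_mult[OF f(1) bmeas_comp[OF f(1) measurable_reindex]] by simp
  have 1: "f (splice_at ?N y z) = f y" for y z
    by (rule depends_onD[OF f(2)]) (auto simp: splice_at_def J_def)
  \<comment> \<open>Off the kernel of \<open>a\<close> the shear sets bit \<open>d\<close> and
    leaves the subcube, so the second look reads the fresh copy \<open>z\<close> there; on the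
    kernel both looks share \<open>y\<close>.\<close>
  have 2: "f (\<lambda>k. splice_at ?N y z (shear d a k)) = f (splice_at ?S y (\<lambda>k. z (xor k (2 ^ d))))" for y z
  proof (rule depends_onD[OF f(2)])
    fix k assume k: "k \<in> J"
    then have "\<not> bit k d" by (simp add: J_def bit_iff_odd)
    then have "bit (xor k (2 ^ d)) d" by (simp add: bit_xor_iff bit_exp_iff)
    then have "xor k (2 ^ d) \<notin> ?N" by (auto simp: bit_iff_odd)
    with k show "splice_at ?N y z (shear d a k) = splice_at ?S y (\<lambda>k. z (xor k (2 ^ d))) k"
      by (auto simp: splice_at_def shear_def J_def)
  qed
  have inj: "inj (\<lambda>k::nat. xor k (2 ^ d))"
    by (rule inj_on_inverseI[of _ "\<lambda>k. xor k (2 ^ d)"]) (simp add: xor.assoc)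
  have "(\<integral>y. ?H y \<partial>iid P) = (\<integral>y. \<integral>z. ?H (splice_at ?N y z) \<partial>iid P \<partial>iid P)"
    by (rule one.integral_splice[OF H])
  also have "\<dots> = (\<integral>y. f y * (\<integral>z. f (splice_at ?S y (\<lambda>k. z (xor k (2 ^ d)))) \<partial>iid P) \<partial>iid P)"
    by (simp add: 1 2)
  also have "\<dots> = (\<integral>y. one.cond ?S f y * f y \<partial>iid P)"
    using one.integral_reindex[OF one.bmeas_splice inj, of f ?S] f by (simp add: one.cond_def mult.commute)
  also have "\<dots> = one.energy f ?S"
    using f by (simp add: one.integral_cond_mult one.energy_def power2_eq_square)
  finally show ?thesis .
qed

lemma RM_quality_two_looks:
  fixes r d :: nat and a :: "nat set" and \<alpha> :: real
  assumes a: "a \<subseteq> {..<d}"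
  defines "J \<equiv> {..<2 ^ d} - {0::nat}"
  defines "f \<equiv> est (RM r d) J 0"
  defines "q \<equiv> RM_quality r d"
  shows "4 * \<alpha> * q - \<alpha>\<^sup>2 * (2 * q + 2 * one.energy f {k \<in> J. even (card {j \<in> a. bit k j})})
    \<le> RM_quality r (Suc d)"
proof -
  let ?J = "{..<2 ^ Suc d} - {0::nat}"
  have f: "bmeas f" "depends_on J f" "odd_fun (RM r d) 0 f"
    unfolding f_def
    by (auto intro!: bmeas_est depends_on_est odd_fun_est linear_code_RM finite_RM simp: J_def)
  have q: "(\<integral>y. f y \<partial>iid P) = q" "(\<integral>y. (f y)\<^sup>2 \<partial>iid P) = q"
    using integral_est[OF linear_code_RM, of J r d 0]
    by (simp_all add: f_def q_def J_def RM_quality_def quality_def)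
  { fix a :: "nat set" assume a: "a \<subseteq> {..<d}"
    let ?h = "\<lambda>y. f (\<lambda>k. y (shear d a k))"
    have "bmeas ?h" by (rule bmeas_comp[OF f(1) measurable_reindex])
    moreover have "depends_on ?J ?h"
      unfolding depends_on_def
    proof (intro allI impI depends_onD[OF f(2)])
      fix y z :: "nat \<Rightarrow> 'a" and k assume "\<forall>k\<in>?J. y k = z k" "k \<in> J"
      then show "y (shear d a k) = z (shear d a k)"
        using shear_less[of k d a] shear_eq_0_iff[OF a, of k] by (auto simp: J_def)
    qed
    \<comment> \<open>Restricting a long codeword to the hyperplane gives a codeword of
      \<open>RM r d\<close> with the same bit at 0, so oddness carries over from the short
      code.\<close>
    moreover have "odd_fun (RM r (Suc d)) 0 ?h"
      unfolding odd_fun_def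
    proof (intro ballI allI)
      fix u y assume u: "u \<in> RM r (Suc d)"
      define u' where "u' = (\<lambda>k. if k < 2 ^ d then u (shear d a k) else False)"
      have u': "u' \<in> RM r d" unfolding u'_def by (rule RM_shear[OF u a])
      have "f (\<lambda>k. flip u y (shear d a k)) = f (flip u' (\<lambda>k. y (shear d a k)))"
        by (rule depends_onD[OF f(2)]) (auto simp: flip_def u'_def J_def)
      also have "\<dots> = bpsk (u' 0) * f (\<lambda>k. y (shear d a k))"
        using f(3) u' by (simp add: odd_fun_def)
      finally show "f (\<lambda>k. flip u y (shear d a k)) = bpsk (u 0) * f (\<lambda>k. y (shear d a k))"
        by (simp add: u'_def)
    qed
    moreover have "(\<integral>y. ?h y \<partial>iid P) = q" "(\<integral>y. (?h y)\<^sup>2 \<partial>iid P) = q"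
      using one.integral_reindex[OF _ inj_shear[OF a], of f]
        one.integral_reindex[OF _ inj_shear[OF a], of "\<lambda>y. (f y)\<^sup>2"] f q
      by (simp_all add: bmeas_power2)
    ultimately have "bmeas ?h" "depends_on ?J ?h" "odd_fun (RM r (Suc d)) 0 ?h"
      "(\<integral>y. ?h y \<partial>iid P) = q" "(\<integral>y. (?h y)\<^sup>2 \<partial>iid P) = q" .
  } note look = this
  \<comment> \<open>The zero functional yields the subcube itself, which serves as the first
    look.\<close>
  have "shear d {} k = k" for k by (simp add: shear_def)
  then have look0: "bmeas f" "depends_on ?J f" "odd_fun (RM r (Suc d)) 0 f"
    using look[of "{}"] by simp_all
  have "4 * \<alpha> * q - \<alpha>\<^sup>2 * (2 * q + 2 * one.energy f {k \<in> J. even (card {j \<in> a. bit k j})})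
      \<le> quality (RM r (Suc d)) ?J 0"
    by (rule quality_two_looks[OF linear_code_RM _ look0 look(1,2,3)[OF a] q look(4,5)[OF a]])
       (auto simp: integral_est_shear[OF f(1) f(2)[unfolded J_def], folded J_def])
  then show ?thesis by (simp add: RM_quality_def)
qed

lemma RM_quality_Suc:
  "4 * RM_quality r d / (3 + RM_quality r d) \<le> RM_quality r (Suc d)"
proof -
  define J where "J = {..<2 ^ d} - {0::nat}"
  define f where "f = est (RM r d) J 0"
  define q where "q = RM_quality r d"
  define S where "S a = {k \<in> J. even (card {j \<in> a. bit k j})}" for a :: "nat set"
  \<comment> \<open>The maximizer of 4 \<alpha> q - \<alpha>^2 (3 q + q^2), the averaged two-look
    bound.\<close>
  define \<alpha> where "\<alpha> = 2 / (3 + q)"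
  have q0: "0 \<le> q" by (simp add: q_def RM_quality_range)
  \<comment> \<open>All functionals take part, even the zero one, for which the two looks coincide;
    with it the count is exactly one half for each nonzero point.\<close>
  have "(\<Sum>a\<in>Pow {..<d}. one.energy f (S a))
      \<le> real (card (Pow {..<d})) * ((\<integral>y. f y \<partial>iid P)\<^sup>2 + 1/2 * ((\<integral>y. (f y)\<^sup>2 \<partial>iid P) - (\<integral>y. f y \<partial>iid P)\<^sup>2))"
  proof (rule one.sum_energy_le)
    show "one.bmeas f" by (simp add: f_def bmeas_est finite_RM J_def)
    show "depends_on {..<2 ^ d} f" unfolding f_def by (rule depends_on_est) (auto simp: J_def)
    show "S a \<subseteq> {..<2 ^ d}" for a by (auto simp: S_def J_def)
    fix k :: nat assume k: "k < 2 ^ d"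
    show "real (card {a \<in> Pow {..<d}. k \<in> S a}) \<le> 1 / 2 * real (card (Pow {..<d}))"
    proof (cases "k = 0")
      case False
      then obtain j where j: "bit k j" using bit_eq_iff[of k 0] by auto
      have "j < d"
      proof (rule ccontr)
        assume "\<not> j < d"
        then have "k < 2 ^ j" using k by (meson less_le_trans linorder_not_less one_le_numeral power_increasing)
        with j show False by (simp add: bit_iff_odd)
      qed
      then have "2 * card {a \<in> Pow {..<d}. even (card {i \<in> a. bit k i})} = 2 ^ card {..<d}"
        using j by (intro card_even_subsets[of _ j]) auto
      moreover have "{a \<in> Pow {..<d}. k \<in> S a} = {a \<in> Pow {..<d}. even (card {i \<in> a. bit k i})}"
        using False k by (auto simp: S_def J_def)
      ultimately have "real (2 * card {a \<in> Pow {..<d}. k \<in> S a}) = real (2 ^ d)" by simp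
      then show ?thesis by (simp add: card_Pow)
    qed (simp add: S_def J_def)
  qed simp
  then have E: "(\<Sum>a\<in>Pow {..<d}. one.energy f (S a)) \<le> 2 ^ d * (q\<^sup>2 + (q - q\<^sup>2) / 2)"
    using integral_est[OF linear_code_RM, of J r d 0]
    by (simp add: card_Pow f_def q_def J_def RM_quality_def quality_def)
  have "(\<Sum>a\<in>Pow {..<d}. 4 * \<alpha> * q - \<alpha>\<^sup>2 * (2 * q + 2 * one.energy f (S a)))
      \<le> (\<Sum>a\<in>Pow {..<d}. RM_quality r (Suc d))"
    unfolding f_def q_def S_def J_def by (intro sum_mono RM_quality_two_looks) auto
  then have "2 ^ d * (4 * \<alpha> * q - \<alpha>\<^sup>2 * (2 * q)) - 2 * \<alpha>\<^sup>2 * (\<Sum>a\<in>Pow {..<d}. one.energy f (S a))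
      \<le> 2 ^ d * RM_quality r (Suc d)"
    by (simp add: sum_subtractf distrib_left sum.distrib card_Pow sum_distrib_left[symmetric] algebra_simps)
  moreover have "2 * \<alpha>\<^sup>2 * (\<Sum>a\<in>Pow {..<d}. one.energy f (S a)) \<le> 2 * \<alpha>\<^sup>2 * (2 ^ d * (q\<^sup>2 + (q - q\<^sup>2) / 2))"
    by (intro mult_left_mono E) simp
  ultimately have "2 ^ d * (4 * \<alpha> * q - \<alpha>\<^sup>2 * (2 * q)) - 2 * \<alpha>\<^sup>2 * (2 ^ d * (q\<^sup>2 + (q - q\<^sup>2) / 2))
      \<le> 2 ^ d * RM_quality r (Suc d)" by linarith
  also have "2 ^ d * (4 * \<alpha> * q - \<alpha>\<^sup>2 * (2 * q)) - 2 * \<alpha>\<^sup>2 * (2 ^ d * (q\<^sup>2 + (q - q\<^sup>2) / 2))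
      = 2 ^ d * (q * (4 * \<alpha> - \<alpha> * (\<alpha> * (3 + q))))"
    by (simp add: field_simps power2_eq_square)
  also have "\<alpha> * (3 + q) = 2" using q0 by (simp add: \<alpha>_def field_simps)
  finally have "q * (2 * \<alpha>) \<le> RM_quality r (Suc d)" by (simp add: algebra_simps)
  then show ?thesis by (simp add: \<alpha>_def q_def mult.commute)
qed

text \<open>As 1 - 4 q / (3 + q) = 3 (1 - q) / (3 + q), a step contracts the error by 3 / (3 +
  \<delta>) while \<open>q\<close> stays above \<open>\<delta>\<close>; the induction carries this
  lower bound along.\<close>

lemma RM_quality_converges:
  assumes "\<delta> \<le> RM_quality r d" "0 \<le> \<delta>"
  shows "1 - (3 / (3 + \<delta>)) ^ j \<le> RM_quality r (d + j)"
proof -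
  have "\<delta> \<le> RM_quality r (d + j) \<and> 1 - RM_quality r (d + j) \<le> (3 / (3 + \<delta>)) ^ j"
  proof (induction j)
    case 0
    with assms RM_quality_range[of r d] show ?case by simp
  next
    case (Suc j)
    define q where "q = RM_quality r (d + j)"
    have q: "\<delta> \<le> q" "0 \<le> q" "q \<le> 1" "1 - q \<le> (3 / (3 + \<delta>)) ^ j"
      using Suc.IH RM_quality_range by (auto simp: q_def)
    have S: "4 * q / (3 + q) \<le> RM_quality r (d + Suc j)"
      using RM_quality_Suc[of r "d + j"] by (simp add: q_def)
    have "q \<le> 4 * q / (3 + q)"
      using q by (simp add: field_simps mult_left_le)
    with q(1) S have 1: "\<delta> \<le> RM_quality r (d + Suc j)" by linarith
    have "1 - RM_quality r (d + Suc j) \<le> 1 - 4 * q / (3 + q)" using S by simp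
    also have "\<dots> = 3 / (3 + q) * (1 - q)" using q by (simp add: field_simps)
    also have "\<dots> \<le> 3 / (3 + \<delta>) * (3 / (3 + \<delta>)) ^ j"
      using q assms(2) by (intro mult_mono divide_left_mono) auto
    finally show ?case using 1 by simp
  qed
  then show ?thesis by linarith
qed

end

section \<open>Rates of Reed--Muller codes of neighbouring lengths\<close>

text \<open>Pascal's rule summed over the degrees leaves only the boundary term at
  \<open>r\<close>.\<close>

lemma RM_rate_pred: "RM_rate r m = RM_rate r (Suc m) + real (m choose r) / 2 ^ Suc m"
proof -
  have "(\<Sum>i\<le>r. Suc m choose i) + (m choose r) = 2 * (\<Sum>i\<le>r. m choose i)"
    by (induction r) auto
  then have "(\<Sum>i\<le>r. real (Suc m choose i)) + real (m choose r) = 2 * (\<Sum>i\<le>r. real (m choose i))"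
    unfolding of_nat_sum[symmetric] of_nat_add[symmetric] by (simp only: of_nat_mult of_nat_numeral)
  then show ?thesis
    by (simp add: RM_rate_def field_simps)
qed

text \<open>One step multiplies the left side by 4 (2 n + 1) (2 n + 3) / (n + 1)^2, which is below
  16 because (2 n + 1) (2 n + 3) = 4 (n + 1)^2 - 1.\<close>

lemma central_binomial_square_le: "(real ((2 * n) choose n))\<^sup>2 * (2 * real n + 1) \<le> 16 ^ n"
proof (induction n)
  case (Suc n)
  define b where "b = real ((2 * n) choose n)"
  have "((2 * Suc n) choose Suc n) * Suc n = 2 * (2 * n + 1) * ((2 * n) choose n)"
  proof -
    have "Suc n * (Suc (Suc (2 * n)) choose Suc n) = Suc (Suc (2 * n)) * (Suc (2 * n) choose n)"
      by (rule Suc_times_binomial_eq[symmetric, simplified mult.commute])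
    moreover have "Suc n * (Suc (2 * n) choose n) = Suc (2 * n) * ((2 * n) choose n)"
      using Suc_times_binomial_eq[of "2 * n" n] binomial_symmetric[of n "Suc (2 * n)"] by (simp add: mult.commute)
    ultimately have "Suc n * (Suc n * (Suc (Suc (2 * n)) choose Suc n)) = Suc n * (2 * (2 * n + 1) * ((2 * n) choose n))"
      by (simp add: algebra_simps)
    then have "Suc n * (Suc (Suc (2 * n)) choose Suc n) = 2 * (2 * n + 1) * ((2 * n) choose n)"
      unfolding mult_cancel1 by simp
    then show ?thesis by (simp add: mult.commute del: binomial_Suc_Suc)
  qed
  then have "real (((2 * Suc n) choose Suc n) * Suc n) = real (2 * (2 * n + 1) * ((2 * n) choose n))"
    by (rule arg_cong)
  then have e: "real ((2 * Suc n) choose Suc n) = 2 * (2 * real n + 1) * b / (real n + 1)"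
    by (simp add: b_def field_simps del: binomial_Suc_Suc)
  have "(real ((2 * Suc n) choose Suc n))\<^sup>2 * (2 * real (Suc n) + 1)
      = (b\<^sup>2 * (2 * real n + 1)) * (4 * ((2 * real n + 1) * (2 * real n + 3)) / (real n + 1)\<^sup>2)"
    unfolding e by (simp add: field_simps power2_eq_square)
  also have "\<dots> \<le> 16 ^ n * 16"
  proof (rule mult_mono)
    show "b\<^sup>2 * (2 * real n + 1) \<le> 16 ^ n" using Suc.IH by (simp add: b_def)
    show "4 * ((2 * real n + 1) * (2 * real n + 3)) / (real n + 1)\<^sup>2 \<le> 16"
      by (simp add: divide_le_eq power2_eq_square algebra_simps not_less)
  qed auto
  finally show ?case by simp
qed simp

text \<open>An even row is bounded by its central entry; a normalized entry of an odd row is the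
  mean of two entries of the even row before it.\<close>

lemma binomial_div_exp_le:
  assumes "0 < m"
  shows "real (m choose r) / 2 ^ m \<le> 1 / sqrt (real m)"
proof -
  define n where "n = m div 2"
  have even: "real ((2 * n) choose k) / 2 ^ (2 * n) \<le> 1 / sqrt (2 * real n + 1)" for k
  proof -
    have "real ((2 * n) choose k) \<le> real ((2 * n) choose n)"
      using binomial_maximum'[of n k] by simp
    also have "\<dots> \<le> sqrt (16 ^ n / (2 * real n + 1))"
      using central_binomial_square_le[of n] by (intro real_le_rsqrt) (simp add: field_simps)
    also have "\<dots> = 2 ^ (2 * n) / sqrt (2 * real n + 1)"
    proof -
      have "(16::real) ^ n = (2 ^ (2 * n))\<^sup>2" by (simp add: power_mult power2_eq_square flip: power_mult_distrib)
      then show ?thesis by (simp add: real_sqrt_divide)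
    qed
    finally show ?thesis by (simp add: field_simps)
  qed
  have "real (m choose r) / 2 ^ m \<le> 1 / sqrt (2 * real n + 1)"
  proof (cases "even m")
    case True
    then have "m = 2 * n" by (simp add: n_def)
    with even[of r] show ?thesis by simp
  next
    case False
    then have m: "m = Suc (2 * n)" by (simp add: n_def)
    show ?thesis
    proof (cases r)
      case 0
      then have "real (m choose r) / 2 ^ m \<le> real ((2 * n) choose 0) / 2 ^ (2 * n)"
        by (simp add: m divide_simps)
      with even[of 0] show ?thesis by linarith
    next
      case (Suc k)
      have "real (m choose r) / 2 ^ m = (real ((2 * n) choose k) / 2 ^ (2 * n) + real ((2 * n) choose Suc k) / 2 ^ (2 * n)) / 2"
        by (simp add: m Suc field_simps)
      also have "\<dots> \<le> (1 / sqrt (2 * real n + 1) + 1 / sqrt (2 * real n + 1)) / 2"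
        by (intro divide_right_mono add_mono even) simp
      finally show ?thesis by simp
    qed
  qed
  also have "\<dots> \<le> 1 / sqrt (real m)"
  proof -
    have "m \<le> 2 * n + 1" unfolding n_def by presburger
    then have "real m \<le> 2 * real n + 1" by linarith
    then show ?thesis using assms by (intro divide_left_mono) auto
  qed
  finally show ?thesis .
qed

text \<open>Each of the \<open>j\<close> steps costs at most the bound for the smallest dimension
  reached.\<close>

lemma RM_rate_diff_le:
  assumes "j < m"
  shows "RM_rate r (m - j) \<le> RM_rate r m + real j / sqrt (real (m - j))"
  using assms
proof (induction j)
  case (Suc j)
  define k where "k = m - Suc j"
  have k: "m - j = Suc k" "0 < k" using Suc.prems by (auto simp: k_def)
  have "RM_rate r k = RM_rate r (Suc k) + real (k choose r) / 2 ^ k / 2"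
    using RM_rate_pred[of r k] by simp
  also have "\<dots> \<le> RM_rate r (Suc k) + 1 / sqrt (real k)"
  proof -
    have "real (k choose r) / 2 ^ k / 2 \<le> real (k choose r) / 2 ^ k"
      by (rule order_trans[OF divide_left_mono[of 1 2]]) auto
    also have "\<dots> \<le> 1 / sqrt (real k)" by (rule binomial_div_exp_le[OF k(2)])
    finally show ?thesis by simp
  qed
  also have "\<dots> \<le> RM_rate r m + real j / sqrt (real (Suc k)) + 1 / sqrt (real k)"
    using Suc by (simp add: k)
  also have "real j / sqrt (real (Suc k)) \<le> real j / sqrt (real k)"
    using k by (intro divide_left_mono) auto
  finally show ?case by (simp add: k_def add_divide_distrib)
qed simp

section \<open>Binary memoryless symmetric channels\<close>

locale BMS =
  fixes \<mu> :: "ereal measure" and w :: "real \<Rightarrow> ereal \<Rightarrow> real"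
  assumes BMS: "BMS_channel \<mu> w"
begin

definition out :: "ereal \<Rightarrow> real" where
  "out y = (w 1 y + w (-1) y) / 2"

text \<open>The posterior mean of the input given one output, i.e. tanh of half the log likelihood
  ratio; it is 0 by division where both densities vanish.\<close>

definition soft :: "ereal \<Rightarrow> real" where
  "soft y = (w 1 y - w (-1) y) / (w 1 y + w (-1) y)"

definition law :: "ereal measure" where
  "law = density \<mu> (\<lambda>y. ennreal (out y))"

lemma sets_mu [measurable_cong]: "sets \<mu> = sets borel"
  using BMS by (simp add: BMS_channel_def)

lemma space_mu: "space \<mu> = UNIV"
  using sets_eq_imp_space_eq[OF sets_mu] by simp

lemma w_meas [measurable]: "w 1 \<in> borel_measurable \<mu>" "w (-1) \<in> borel_measurable \<mu>"
  and w_nonneg: "0 \<le> w 1 y" "0 \<le> w (-1) y"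
  and w_int: "(\<integral>\<^sup>+ y. ennreal (w 1 y) \<partial>\<mu>) = 1" "(\<integral>\<^sup>+ y. ennreal (w (-1) y) \<partial>\<mu>) = 1"
  and w_sym: "w 1 y = w (-1) (-y)"
  and mu_sym: "distr \<mu> \<mu> uminus = \<mu>"
  and sigma_finite_mu: "sigma_finite_measure \<mu>"
  using BMS by (auto simp: BMS_channel_def)

lemma w_sym': "w 1 (-y) = w (-1) y"
  using w_sym[of "-y"] by simp

lemma out_meas [measurable]: "out \<in> borel_measurable \<mu>"
  and soft_meas [measurable]: "soft \<in> borel_measurable \<mu>"
  unfolding out_def soft_def by measurable

lemma out_nonneg: "0 \<le> out y"
  using w_nonneg[of y] by (simp add: out_def)

lemma w_eq:
  assumes "x \<in> {1, -1}"
  shows "w x y = (1 + x * soft y) * out y"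
proof (cases "w 1 y + w (-1) y = 0")
  case True
  with w_nonneg[of y] have "w 1 y = 0" "w (-1) y = 0" by linarith+
  with assms show ?thesis by (auto simp: out_def)
next
  case False
  then have "soft y * out y = (w 1 y - w (-1) y) / 2"
    by (simp add: soft_def out_def)
  moreover have "(1 + x * soft y) * out y = out y + x * (soft y * out y)"
    by (simp add: algebra_simps)
  ultimately show ?thesis using assms by (auto simp: out_def field_simps)
qed

lemma abs_soft_le: "\<bar>soft y\<bar> \<le> 1"
proof -
  have "\<bar>w 1 y - w (-1) y\<bar> \<le> \<bar>w 1 y + w (-1) y\<bar>" using w_nonneg[of y] by linarith
  then show ?thesis by (simp add: soft_def abs_divide divide_le_eq_1)
qed

lemma nn_integral_out: "(\<integral>\<^sup>+ y. ennreal (out y) \<partial>\<mu>) = 1"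
proof -
  have "(\<integral>\<^sup>+ y. ennreal (out y) \<partial>\<mu>) = (\<integral>\<^sup>+ y. (ennreal (w 1 y) + ennreal (w (-1) y)) / 2 \<partial>\<mu>)"
    unfolding out_def using w_nonneg
    by (intro nn_integral_cong) (simp add: ennreal_plus[symmetric] divide_ennreal[symmetric] del: ennreal_plus)
  also have "\<dots> = (1 + 1) / 2"
    by (simp add: nn_integral_divide nn_integral_add w_int)
  finally show ?thesis by simp
qed

lemma distr_law: "distr law law uminus = law"
proof (rule measure_eqI)
  fix A assume "A \<in> sets (distr law law uminus)"
  then have A[measurable]: "A \<in> sets \<mu>" by (simp add: law_def)
  have out_sym: "out (-y) = out y" for y by (simp add: out_def w_sym' w_sym[symmetric])
  have m[measurable]: "uminus \<in> measurable \<mu> \<mu>"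
    by (simp add: measurable_cong_sets[OF sets_mu sets_mu])
  have "emeasure (distr law law uminus) A = emeasure law (uminus -` A \<inter> space \<mu>)"
    by (subst emeasure_distr) (auto simp: law_def space_mu)
  also have "\<dots> = (\<integral>\<^sup>+ y. ennreal (out y) * indicator (uminus -` A \<inter> space \<mu>) y \<partial>\<mu>)"
    unfolding law_def by (rule emeasure_density) auto
  also have "\<dots> = (\<integral>\<^sup>+ y. ennreal (out (-y)) * indicator A (-y) \<partial>\<mu>)"
    by (intro nn_integral_cong) (auto simp: out_sym indicator_def space_mu)
  also have "\<dots> = (\<integral>\<^sup>+ y. ennreal (out y) * indicator A y \<partial>distr \<mu> \<mu> uminus)"
    by (rule nn_integral_distr[symmetric]) auto
  also have "\<dots> = emeasure law A"
    unfolding mu_sym law_def by (rule emeasure_density[symmetric]) auto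
  finally show "emeasure (distr law law uminus) A = emeasure law A" .
qed simp

sublocale symmetric_channel law soft uminus
proof (intro symmetric_channel.intro iid_space.intro prob_spaceI iid_space_axioms.intro symmetric_channel_axioms.intro)
  show "emeasure law (space law) = 1"
    by (simp add: law_def emeasure_density nn_integral_out cong: nn_integral_cong)
  show "space law = UNIV" by (simp add: law_def space_mu)
  show "uminus \<in> measurable law law"
    by (simp add: law_def measurable_cong_sets[OF sets_mu sets_mu])
  show "soft (-y) = - soft y" for y
    by (simp add: soft_def w_sym' w_sym[symmetric] add.commute flip: divide_minus_left)
  show "soft \<in> borel_measurable law" by (simp add: law_def)
qed (simp_all add: abs_soft_le distr_law)

section \<open>Bit-MAP errors and the quality of the estimate\<close>

lemma PiM_law:
  "finite J \<Longrightarrow> PiM J (\<lambda>_. law) = density (PiM J (\<lambda>_. \<mu>)) (\<lambda>y. \<Prod>j\<in>J. ennreal (out (y j)))"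
  unfolding law_def
  by (rule PiM_density) (auto simp: law_def[symmetric] sigma_finite_mu prob_space_axioms)

lemma likelihood_eq: "likelihood w N v y = (\<Prod>j<N. out (y j)) * lik {..<N} v y"
proof -
  have "w (bpsk b) y = out y * (1 + bpsk b * soft y)" for b y
    by (subst w_eq) (auto simp: bpsk_def)
  then show ?thesis by (simp add: likelihood_def lik_def prod.distrib)
qed

text \<open>The common factor of all likelihoods cancels in the posterior; the posteriors of the two
  signs then differ by the signed estimate.\<close>

lemma est_le_0_if_error:
  assumes C: "linear_code C" and err: "bitMAP_error w C N i u y" and pos: "(\<Prod>j<N. out (y j)) > 0"
  shows "bpsk (u i) * est C {..<N} i y \<le> 0"
proof -
  define G where "G = (\<Prod>j<N. out (y j))"
  define x where "x = bpsk (u i)"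
  define L where "L v = lik {..<N} v y" for v
  have x: "x = 1 \<or> x = -1" by (auto simp: x_def bpsk_def)
  have fin: "finite C" "card C > 0" using C by (auto simp: linear_code_def card_gt_0_iff)
  have sums: "(\<Sum>v\<in>{v\<in>C. bpsk (v i) = z}. likelihood w N v y) = G * (\<Sum>v\<in>C. if bpsk (v i) = z then L v else 0)" for z
    using fin by (simp add: likelihood_eq sum.inter_filter L_def G_def sum_distrib_left if_distrib cong: if_cong)
  have "posterior w C N i x y - posterior w C N i (-x) y
      = (\<Sum>v\<in>C. (if bpsk (v i) = x then L v else 0) - (if bpsk (v i) = -x then L v else 0)) / (\<Sum>v\<in>C. L v)"
    using pos unfolding posterior_def sums
    by (simp add: likelihood_eq sum_distrib_left[symmetric] G_def[symmetric] L_def[symmetric]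
        sum_subtractf diff_divide_distrib)
  also have "(\<Sum>v\<in>C. (if bpsk (v i) = x then L v else 0) - (if bpsk (v i) = -x then L v else 0))
      = (\<Sum>v\<in>C. x * (bpsk (v i) * L v))"
    using x by (intro sum.cong refl) (auto simp: bpsk_def)
  also have "\<dots> / (\<Sum>v\<in>C. L v) = x * est C {..<N} i y"
    using fin by (simp add: est_def num_def den_def L_def sum_distrib_left)
  finally show ?thesis
    using err by (simp add: bitMAP_error_def x_def)
qed

text \<open>The signed estimate is at most 0 on an error and at most 1 always, so one minus it
  dominates the error indicator, ties included. Its mean is one minus the quality.\<close>

lemma bitMAP_error_prob_le:
  assumes C: "linear_code C"
  shows "bitMAP_error_prob \<mu> w C N i \<le> ennreal (1 - quality C {..<N} i)"
proof -
  let ?J = "{..<N}"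
  define f where "f = est C ?J i"
  define g where "g u y = (1 - bpsk (u i) * f y) * lik ?J u y" for u y
  have fin: "finite C" "card C > 0" "C \<noteq> {}" using C by (auto simp: linear_code_def card_gt_0_iff)
  have f: "bmeas f" "\<bar>f y\<bar> \<le> 1" "depends_on ?J f" for y
    using fin by (auto simp: f_def intro: bmeas_est abs_est_le depends_on_est)
  have xf: "0 \<le> 1 - bpsk b * f y" for b y
    using f(2)[of y] by (auto simp: bpsk_def abs_le_iff)
  have g: "0 \<le> g u y" "bmeas (g u)" for u y
    unfolding g_def by (auto intro!: mult_nonneg_nonneg xf lik_nonneg bmeas_mult bmeas_diff bmeas_const f(1) bmeas_lik)
  have dg: "depends_on ?J (\<lambda>y. ennreal (g u y))" for u
    unfolding g_def
    by (rule depends_on_combine[OF f(3), of "lik ?J u" "\<lambda>a b. ennreal ((1 - bpsk (u i) * a) * b)"])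
       (auto simp: depends_on_def intro: lik_cong)
  have le: "(\<integral>\<^sup>+ y. indicator {y. bitMAP_error w C N i u y} y * ennreal (likelihood w N u y) \<partial>PiM ?J (\<lambda>_. \<mu>))
      \<le> ennreal (\<integral>y. g u y \<partial>iid law)" for u
  proof -
    have "(\<integral>\<^sup>+ y. indicator {y. bitMAP_error w C N i u y} y * ennreal (likelihood w N u y) \<partial>PiM ?J (\<lambda>_. \<mu>))
        \<le> (\<integral>\<^sup>+ y. (\<Prod>j\<in>?J. ennreal (out (y j))) * ennreal (g u y) \<partial>PiM ?J (\<lambda>_. \<mu>))"
    proof (rule nn_integral_mono)
      fix y
      define G where "G = (\<Prod>j<N. out (y j))"
      have G: "0 \<le> G" by (simp add: G_def prod_nonneg out_nonneg)
      have "indicator {y. bitMAP_error w C N i u y} y * likelihood w N u y \<le> G * g u y"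
      proof (cases "bitMAP_error w C N i u y \<and> G > 0")
        case True
        then have "bpsk (u i) * f y \<le> 0"
          using est_le_0_if_error[OF C] by (simp add: f_def G_def)
        then have "1 * lik ?J u y \<le> (1 - bpsk (u i) * f y) * lik ?J u y"
          by (intro mult_right_mono lik_nonneg) simp
        then show ?thesis
          using True by (simp add: likelihood_eq G_def[symmetric] g_def)
      next
        \<comment> \<open>Without an error the left side is 0; with one the common factor vanishes,
          and the likelihood with it.\<close>
        case False
        with G have "bitMAP_error w C N i u y \<Longrightarrow> G = 0" by auto
        then show ?thesis
          using G g(1) by (cases "bitMAP_error w C N i u y") (auto simp: likelihood_eq G_def[symmetric])
      qed
      then have "ennreal (indicator {y. bitMAP_error w C N i u y} y * likelihood w N u y) \<le> ennreal (G * g u y)"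
        by (rule ennreal_leI)
      then show "indicator {y. bitMAP_error w C N i u y} y * ennreal (likelihood w N u y)
          \<le> (\<Prod>j\<in>?J. ennreal (out (y j))) * ennreal (g u y)"
        using G g(1)[of u y]
        by (simp add: prod_ennreal out_nonneg G_def[symmetric] ennreal_mult' ennreal_indicator[symmetric] split: split_indicator)
    qed
    also have "\<dots> = (\<integral>\<^sup>+ y. ennreal (g u y) \<partial>PiM ?J (\<lambda>_. law))"
    proof -
      have gm: "(\<lambda>y. ennreal (g u y)) \<in> borel_measurable (PiM ?J (\<lambda>_. law))"
        using bmeas_measurable[OF g(2)] by (intro measurable_depends_on[OF _ dg space_UNIV]) simp
      have "sets (PiM ?J (\<lambda>_. law)) = sets (PiM ?J (\<lambda>_. \<mu>))"
        by (intro sets_PiM_cong) (auto simp: law_def)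
      with gm have [measurable]: "(\<lambda>y. ennreal (g u y)) \<in> borel_measurable (PiM ?J (\<lambda>_. \<mu>))"
        using measurable_cong_sets[of "PiM ?J (\<lambda>_. law)" "PiM ?J (\<lambda>_. \<mu>)" borel borel] by blast
      show ?thesis
        unfolding PiM_law[OF finite_lessThan] by (subst nn_integral_density) auto
    qed
    also have "\<dots> = (\<integral>\<^sup>+ y. ennreal (g u y) \<partial>iid law)"
      using bmeas_measurable[OF g(2)]
      by (intro nn_integral_iid_depends_on[symmetric] prob_space_axioms space_UNIV dg) auto
    also have "\<dots> = ennreal (\<integral>y. g u y \<partial>iid law)"
      using g by (intro nn_integral_eq_integral bmeas_integrable) auto
    finally show ?thesis .
  qed
  have "(\<Sum>u\<in>C. \<integral>\<^sup>+ y. indicator {y. bitMAP_error w C N i u y} y * ennreal (likelihood w N u y) \<partial>PiM ?J (\<lambda>_. \<mu>))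
      \<le> (\<Sum>u\<in>C. ennreal (\<integral>y. g u y \<partial>iid law))"
    by (intro sum_mono le)
  also have "\<dots> = ennreal (\<Sum>u\<in>C. \<integral>y. g u y \<partial>iid law)"
    using g by (intro sum_ennreal) auto
  also have "(\<Sum>u\<in>C. \<integral>y. g u y \<partial>iid law) = (\<integral>y. (\<Sum>u\<in>C. g u y) \<partial>iid law)"
    using g by (intro Bochner_Integration.integral_sum[symmetric] bmeas_integrable)
  also have "\<dots> = (\<integral>y. real (card C) * (den C ?J y - f y * num C ?J i y) \<partial>iid law)"
  proof (intro Bochner_Integration.integral_cong refl)
    fix y
    have D: "(\<Sum>u\<in>C. lik ?J u y) = real (card C) * den C ?J y"
      and N: "(\<Sum>u\<in>C. bpsk (u i) * lik ?J u y) = real (card C) * num C ?J i y"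
      using fin by (simp_all add: den_def num_def)
    have "(\<Sum>u\<in>C. g u y) = (\<Sum>u\<in>C. lik ?J u y) - f y * (\<Sum>u\<in>C. bpsk (u i) * lik ?J u y)"
      by (simp add: g_def algebra_simps sum_subtractf sum_distrib_left)
    then show "(\<Sum>u\<in>C. g u y) = real (card C) * (den C ?J y - f y * num C ?J i y)"
      unfolding D N by (simp add: algebra_simps)
  qed
  also have "\<dots> = real (card C) * (1 - quality C ?J i)"
    using integral_odd_fun[OF C _ f(1,3), of i] integral_den[OF C, of ?J] integral_est[OF C, of ?J i] odd_fun_est[OF C, of i ?J]
    by (simp add: bmeas_integrable bmeas_den bmeas_num bmeas_mult f fin) (simp add: f_def)
  finally have "bitMAP_error_prob \<mu> w C N i \<le> ennreal (real (card C) * (1 - quality C ?J i)) / of_nat (card C)"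
    unfolding bitMAP_error_prob_def by (rule divide_right_mono_ennreal)
  also have "\<dots> = ennreal (1 - quality C ?J i)"
    using fin quality_le_1[OF C, of ?J i]
    by (simp add: ennreal_of_nat_eq_real_of_nat divide_ennreal)
  finally show ?thesis .
qed

text \<open>The decoder also sees the output of bit \<open>i\<close>, which the extrinsic estimate
  omits; this can only raise the quality.\<close>

lemma bitMAP_error_prob_RM_le:
  assumes "i < 2 ^ m"
  shows "bitMAP_error_prob \<mu> w (RM r m) (2 ^ m) i \<le> ennreal (1 - RM_quality r m)"
proof -
  have "RM_quality r m \<le> quality (RM r m) {..<2 ^ m} i"
    unfolding quality_RM_translate[OF assms, symmetric] by (intro quality_mono linear_code_RM) auto
  then show ?thesis
    by (intro order_trans[OF bitMAP_error_prob_le[OF linear_code_RM]] ennreal_leI) simp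
qed

section \<open>Capacity in bits and in nats\<close>

definition joint :: "real \<times> ereal \<Rightarrow> real" where
  "joint p = w (fst p) (snd p) / 2"

text \<open>Relative to \<open>law\<close> the mutual information integrand for input
  \<open>x\<close> is a function of \<open>x * soft y\<close>; the output symmetry makes both inputs
  contribute equally.\<close>

lemma capacity_eq: "capacity \<mu> w = cap / ln 2"
proof -
  let ?S = "count_space {1, -1 :: real}"
  let ?M = "joint_law \<mu> w"
  interpret mu: sigma_finite_measure \<mu> by (rule sigma_finite_mu)
  interpret S: sigma_finite_measure ?S by (rule sigma_finite_measure_count_space_finite) simp
  interpret pair_sigma_finite ?S \<mu> ..
  have joint_meas[measurable]: "joint \<in> borel_measurable (?S \<Otimes>\<^sub>M \<mu>)"
    unfolding joint_def by (rule measurable_pair_measure_countable1) auto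
  have M: "?M = density (?S \<Otimes>\<^sub>M \<mu>) (\<lambda>p. ennreal (joint p))"
    by (simp add: joint_law_def joint_def case_prod_beta')
  have int1: "(\<integral>\<^sup>+ y. ennreal (joint (x, y)) \<partial>\<mu>) = ennreal (1 / 2)" if "x \<in> {1, -1}" for x
  proof -
    have "(\<integral>\<^sup>+ y. ennreal (joint (x, y)) \<partial>\<mu>) = (\<integral>\<^sup>+ y. ennreal (w x y) / 2 \<partial>\<mu>)"
      using that w_nonneg unfolding joint_def
      by (intro nn_integral_cong) (auto simp: divide_ennreal[symmetric])
    also have "\<dots> = 1 / 2"
      using that w_int by (subst nn_integral_divide) auto
    finally show ?thesis by (simp add: divide_ennreal_def)
  qed
  have int2: "(\<integral>\<^sup>+ x. ennreal (joint (x, y)) \<partial>?S) = ennreal (out y)" for y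
    using w_nonneg[of y]
    by (simp add: nn_integral_count_space_finite joint_def out_def add_divide_distrib ennreal_plus[symmetric] del: ennreal_plus)
  have "prob_space ?M"
  proof
    have "emeasure ?M (space ?M) = (\<integral>\<^sup>+ p. ennreal (joint p) \<partial>(?S \<Otimes>\<^sub>M \<mu>))"
      by (simp add: M emeasure_density cong: nn_integral_cong)
    also have "\<dots> = (\<integral>\<^sup>+ x. \<integral>\<^sup>+ y. ennreal (joint (x, y)) \<partial>\<mu> \<partial>?S)"
      by (rule mu.nn_integral_fst[symmetric]) simp
    also have "\<dots> = 1"
      using ennreal_divide_self[of 2]
      by (simp add: nn_integral_count_space_finite int1 divide_ennreal_def)
    finally show "emeasure ?M (space ?M) = 1" .
  qed
  then interpret J: information_space ?M 2
    by (intro information_space.intro information_space_axioms.intro) auto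
  have dJ: "distributed ?M (?S \<Otimes>\<^sub>M \<mu>) (\<lambda>p. (fst p, snd p)) (\<lambda>p. ennreal (joint p))"
  proof -
    have "distr ?M (?S \<Otimes>\<^sub>M \<mu>) (\<lambda>p. p) = ?M"
      by (rule distr_id2) (simp add: M)
    then show ?thesis by (simp add: distributed_def M)
  qed
  have dX: "distributed ?M ?S fst (\<lambda>_. ennreal (1 / 2))"
    by (rule distributed_cong_density[THEN iffD1, OF _ _ _ J.distr_marginal1[OF S.sigma_finite_measure_axioms mu.sigma_finite_measure_axioms dJ]])
       (auto simp: AE_count_space int1)
  have dY: "distributed ?M \<mu> snd (\<lambda>y. ennreal (out y))"
    using J.distr_marginal2[OF S.sigma_finite_measure_axioms mu.sigma_finite_measure_axioms dJ] by (simp add: int2)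
  define \<eta> where "\<eta> t = (1 + t) * log 2 (1 + t)" for t :: real
  have \<eta>_meas[measurable]: "\<eta> \<in> borel_measurable borel" unfolding \<eta>_def by measurable
  \<comment> \<open>The integrand of the mutual information, with marginal densities
    \<open>1 / 2\<close> and \<open>out\<close>.\<close>
  define F where "F p = joint p * log 2 (joint p / (1 / 2 * out (snd p)))" for p
  have F: "F (x, y) = out y * (\<eta> (x * soft y) / 2)" if "x \<in> {1, -1}" for x y
  proof (cases "out y = 0")
    case False
    then show ?thesis
      using w_eq[OF that, of y] by (simp add: F_def joint_def \<eta>_def)
  qed (use w_eq[OF that, of y] in \<open>simp add: F_def joint_def\<close>)
  \<comment> \<open>The 5 is 1 + 2^2, from \<open>abs_mult_ln_le\<close> at
    \<open>1 + t \<le> 2\<close>.\<close>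
  have b: "\<bar>\<eta> t\<bar> \<le> 5 / ln 2" if "\<bar>t\<bar> \<le> 1" for t
  proof -
    have "\<bar>(1 + t) * ln (1 + t)\<bar> \<le> 1 + (1 + t)\<^sup>2"
      using that by (intro abs_mult_ln_le) (auto simp: abs_le_iff)
    also have "(1 + t)\<^sup>2 \<le> 2\<^sup>2"
      using that by (intro power_mono) (auto simp: abs_le_iff)
    finally show ?thesis by (simp add: \<eta>_def log_def abs_mult field_simps)
  qed
  have xs: "\<bar>x * soft y\<bar> \<le> 1" if "x \<in> {1, -1}" for x y
    using that abs_soft_le[of y] by auto
  have int_law: "integrable law (\<lambda>y. \<eta> (x * soft y) / 2)" if "x \<in> {1, -1}" for x
  proof (rule integrable_const_bound[of _ "5 / ln 2"])
    have "\<bar>\<eta> (x * soft y) / 2\<bar> \<le> 5 / ln 2" for y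
      using b[OF xs[OF that, of y]] by simp
    then show "AE y in law. norm (\<eta> (x * soft y) / 2) \<le> 5 / ln 2" by simp
  qed simp
  have intF: "integrable \<mu> (\<lambda>y. F (x, y))" and eqF: "(\<integral>y. F (x, y) \<partial>\<mu>) = (\<integral>y. \<eta> (x * soft y) / 2 \<partial>law)"
    if "x \<in> {1, -1}" for x
    using int_law[OF that] out_nonneg unfolding F[OF that] law_def
    by (auto simp: integrable_real_density integral_real_density)
  have F_meas[measurable]: "F \<in> borel_measurable (?S \<Otimes>\<^sub>M \<mu>)"
    unfolding F_def by measurable
  have Fint: "integrable (?S \<Otimes>\<^sub>M \<mu>) F"
    by (rule Fubini_integrable) (auto simp: integrable_count_space AE_count_space intF)
  have "capacity \<mu> w = (\<integral>p. F p \<partial>(?S \<Otimes>\<^sub>M \<mu>))"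
    unfolding capacity_def F_def
    by (rule J.mutual_information_distr[OF S.sigma_finite_measure_axioms mu.sigma_finite_measure_axioms dX _ dY _ dJ])
       (auto simp: out_nonneg joint_def w_nonneg)
  also have "\<dots> = (\<integral>x. \<integral>y. F (x, y) \<partial>\<mu> \<partial>?S)"
    by (rule integral_fst'[OF Fint, symmetric])
  also have "\<dots> = (\<integral>y. \<eta> (soft y) / 2 \<partial>law) + (\<integral>y. \<eta> (- soft y) / 2 \<partial>law)"
    by (simp add: lebesgue_integral_count_space_finite eqF)
  also have "(\<integral>y. \<eta> (- soft y) / 2 \<partial>law) = (\<integral>y. \<eta> (soft y) / 2 \<partial>law)"
  proof -
    have "(\<integral>y. \<eta> (soft y) / 2 \<partial>law) = (\<integral>y. \<eta> (soft y) / 2 \<partial>distr law law uminus)"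
      by (simp add: distr_law)
    also have "\<dots> = (\<integral>y. \<eta> (soft (- y)) / 2 \<partial>law)"
      by (rule integral_distr) auto
    finally show ?thesis by (simp add: psi_sigma)
  qed
  also have "(\<integral>y. \<eta> (soft y) / 2 \<partial>law) + (\<integral>y. \<eta> (soft y) / 2 \<partial>law) = (\<integral>y. \<eta> (soft y) \<partial>law)"
    by simp
  also have "\<dots> = cap / ln 2"
    by (simp add: cap_def \<eta>_def log_def)
  finally show ?thesis .
qed

section \<open>Passage to the limit\<close>

lemma RM_quality_tendsto:
  assumes m: "strict_mono m" and rate: "(\<lambda>n. RM_rate (r n) (m n)) \<longlonglongrightarrow> R" and R: "R < capacity \<mu> w"
  shows "(\<lambda>n. 1 - RM_quality (r n) (m n)) \<longlonglongrightarrow> 0"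
proof (rule LIMSEQ_I)
  fix \<epsilon> :: real assume \<epsilon>: "0 < \<epsilon>"
  \<comment> \<open>Half of the gap between capacity and rate, in nats; the other half absorbs the
    higher rate of the code with \<open>j\<close> fewer variables.\<close>
  define \<delta> where "\<delta> = ln 2 * ((capacity \<mu> w - R) / 2)"
  have \<delta>: "0 < \<delta>" using R by (simp add: \<delta>_def)
  \<comment> \<open>The contraction factor depends on \<open>\<delta>\<close> alone, so the number
    of steps is fixed before \<open>n\<close>.\<close>
  then obtain j where j: "(3 / (3 + \<delta>)) ^ j < \<epsilon>"
    using real_arch_pow_inv[OF \<epsilon>, of "3 / (3 + \<delta>)"] by auto
  have mn: "n \<le> m n" for n by (rule strict_mono_imp_increasing[OF m])
  have "(\<lambda>n. RM_rate (r n) (m n) + real j / sqrt (real (m n - j))) \<longlonglongrightarrow> R + 0"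
  proof (rule tendsto_add[OF rate])
    have "filterlim (\<lambda>n. m n - j) at_top sequentially"
      unfolding filterlim_at_top
    proof
      fix Z show "\<forall>\<^sub>F n in sequentially. Z \<le> m n - j"
        using eventually_ge_at_top[of "Z + j"]
      proof eventually_elim
        case (elim n) with mn[of n] show ?case by simp
      qed
    qed
    then have "filterlim (\<lambda>n. sqrt (real (m n - j))) at_top sequentially"
      by (intro filterlim_compose[OF sqrt_at_top] filterlim_compose[OF filterlim_real_sequentially])
    then show "(\<lambda>n. real j / sqrt (real (m n - j))) \<longlonglongrightarrow> 0"
      by (intro tendsto_divide_0[OF tendsto_const] filterlim_at_top_imp_at_infinity)
  qed
  then have "\<forall>\<^sub>F n in sequentially. RM_rate (r n) (m n) + real j / sqrt (real (m n - j)) < (capacity \<mu> w + R) / 2"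
    using R by (intro order_tendstoD(2)[of _ R]) auto
  moreover have "\<forall>\<^sub>F n in sequentially. j < n" by (rule eventually_gt_at_top)
  ultimately have "\<forall>\<^sub>F n in sequentially. norm (1 - RM_quality (r n) (m n) - 0) < \<epsilon>"
  proof eventually_elim
    case (elim n)
    then have jm: "j < m n" using mn[of n] by simp
    have "RM_rate (r n) (m n - j) < (capacity \<mu> w + R) / 2"
      using RM_rate_diff_le[OF jm, of "r n"] elim by linarith
    then have "ln 2 * RM_rate (r n) (m n - j) \<le> ln 2 * ((capacity \<mu> w + R) / 2)"
      by (intro mult_left_mono) auto
    moreover have "cap = ln 2 * capacity \<mu> w" by (simp add: capacity_eq)
    ultimately have "\<delta> \<le> RM_quality (r n) (m n - j)"
      using RM_quality_ge_rate_gap[of "r n" "m n - j"] by (simp add: \<delta>_def algebra_simps)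
    from RM_quality_converges[OF this, of j] \<delta> jm
    have "1 - RM_quality (r n) (m n) \<le> (3 / (3 + \<delta>)) ^ j" by simp
    with j RM_quality_range(2)[of "r n" "m n"] show ?case by simp
  qed
  then show "\<exists>N. \<forall>n\<ge>N. norm (1 - RM_quality (r n) (m n) - 0) < \<epsilon>"
    by (simp add: eventually_sequentially)
qed

end

theorem theorem1:
  fixes \<mu> :: "ereal measure" and w :: "real \<Rightarrow> ereal \<Rightarrow> real"
    and r m :: "nat \<Rightarrow> nat" and R :: real
  assumes "BMS_channel \<mu> w"
    and "0 < capacity \<mu> w" and "capacity \<mu> w < 1"
    and "\<And>n. r n \<le> m n"
    and "strict_mono (\<lambda>n. (2::nat) ^ m n)"
    and "(\<lambda>n. RM_rate (r n) (m n)) \<longlonglongrightarrow> R"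
    and "0 \<le> R" and "R < capacity \<mu> w"
  shows "(\<lambda>n. Max ((\<lambda>i. bitMAP_error_prob \<mu> w (RM (r n) (m n)) (2 ^ m n) i) ` {..<2 ^ m n}))
           \<longlonglongrightarrow> 0"
proof -
  interpret BMS \<mu> w by unfold_locales fact
  have "strict_mono m"
    using assms(5) by (simp add: strict_mono_def)
  then have "(\<lambda>n. ennreal (1 - RM_quality (r n) (m n))) \<longlonglongrightarrow> ennreal 0"
    by (intro tendsto_ennrealI RM_quality_tendsto[where R=R] assms)
  then have lim: "(\<lambda>n. ennreal (1 - RM_quality (r n) (m n))) \<longlonglongrightarrow> 0" by simp
  show ?thesis
  proof (rule tendsto_sandwich[OF _ _ tendsto_const lim])
    show "\<forall>\<^sub>F n in sequentially. Max ((\<lambda>i. bitMAP_error_prob \<mu> w (RM (r n) (m n)) (2 ^ m n) i) ` {..<2 ^ m n})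
        \<le> ennreal (1 - RM_quality (r n) (m n))"
      by (intro always_eventually allI Max.boundedI) (auto intro: bitMAP_error_prob_RM_le simp: lessThan_empty_iff bot_nat_def)
  qed simp
qed

end
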